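(* Let $\alpha,\alpha',\beta,\beta',\gamma,\rho,p,b,c\in\mathbb{C}$ be such that $\kappa:=p+\frac{b+1}{2}\notin\{0,-1,-2,\ldots\}$. Suppose that $\operatorname{Re}(\gamma)>0$ and $\operatorname{Re}(\rho+p)>\max\{0,\operatorname{Re}(\alpha+\alpha'+\beta-\gamma),\operatorname{Re}(\alpha'-\beta')\}$, and that none of $\rho+p+\beta'$, $\rho+p+\gamma-\alpha-\alpha'$, $\rho+p+\gamma-\alpha'-\beta$ is zero or a negative integer. Then for every $x>0$, $$\left(I_{0,+}^{\alpha,\alpha',\beta,\beta',\gamma}\,t^{\rho-1}\mathcal{W}_{p,b,c}(t)\right)(x)=\frac{x^{\rho+p-\alpha-\alpha'+\gamma-1}}{2^{p}}\,\frac{\Gamma(\rho+p)\,\Gamma(\rho+p+\gamma-\alpha-\alpha'-\beta)\,\Gamma(\rho+p+\beta'-\alpha')}{\Gamma(\rho+p+\beta')\,\Gamma(\rho+p+\gamma-\alpha-\alpha')\,\Gamma(\rho+p+\gamma-\alpha'-\beta)\,\Gamma(\kappa)}$$ $$\times\,{}_6F_7\left[\begin{array}{c}\frac{\rho+p}{2},\ \frac{\rho+p+1}{2},\ \frac{\rho+p+\gamma-\alpha-\alpha'-\beta}{2},\ \frac{\rho+p+\gamma-\alpha-\alpha'-\beta+1}{2},\ \frac{\rho+p+\beta'-\alpha'}{2},\ \frac{\rho+p+\beta'-\alpha'+1}{2}\\ \kappa,\ \frac{\rho+p+\beta'}{2},\ \frac{\rho+p+\beta'+1}{2},\ \frac{\rho+p+\gamma-\alpha-\alpha'}{2},\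 \frac{\rho+p+\gamma-\alpha-\alpha'+1}{2},\ \frac{\rho+p+\gamma-\alpha'-\beta}{2},\ \frac{\rho+p+\gamma-\alpha'-\beta+1}{2}\end{array}\bigg|-\frac{cx^2}{4}\right].$$
   Context: Complex powers of positive reals are $y^{a}=\exp(a\log y)$. $(a)_n=a(a+1)\cdots(a+n-1)$, $(a)_0=1$. Appell's third function (Horn's function) is $F_3(\alpha,\alpha',\beta,\beta';\gamma;u,v)=\sum_{m,n\ge0}\frac{(\alpha)_m(\alpha')_n(\beta)_m(\beta')_n}{(\gamma)_{m+n}\,m!\,n!}u^mv^n$ for $|u|,|v|<1$, extended by analytic continuation in $v$; explicitly, for $|u|<1$ and real $v<1$, $F_3=\sum_{m\ge0}\frac{(\alpha)_m(\beta)_m}{(\gamma)_m m!}u^m\,{}_2F_1(\alpha',\beta';\gamma+m;v)$, where ${}_2F_1$ is the Gauss hypergeometric function continued analytically to $\mathbb{C}\setminus[1,\infty)$. For $\operatorname{Re}(\gamma)>0$ and $x>0$, $$\left(I_{0,+}^{\alpha,\alpha',\beta,\beta',\gamma}f\right)(x)=\frac{x^{-\alpha}}{\Gamma(\gamma)}\int_0^x(x-t)^{\gamma-1}t^{-\alpha'}F_3\left(\alpha,\alpha',\beta,\beta';\gamma;1-\frac{t}{x},1-\frac{x}{t}\right)f(t)\,dt.$$ An expression in $t$ after the operator denotes the function $f(t)$ to which it is applied. The generalized Bessel function of the first kind is $\mathcal{W}_{p,b,c}(z)=\sum_{k=0}^\infty\frac{(-1)^kc^k}{\Gamma(p+\frac{b+1}{2}+k)\,k!}\left(\frac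 z2\right)^{2k+p}$. The generalized hypergeometric function is ${}_rF_q\left[\begin{array}{c}a_1,\ldots,a_r\\c_1,\ldots,c_q\end{array}\Big|z\right]=\sum_{k=0}^\infty\frac{(a_1)_k\cdots(a_r)_k}{(c_1)_k\cdots(c_q)_k\,k!}z^k$, where none of the $c_j$ is zero or a negative integer. *)

theory Defs
  imports "HOL-Analysis.Analysis"
begin

text \<open>
  The generalized hypergeometric series. The factor \<open>1 / k!\<close> is built into \<^const>\<open>fps_hypergeo\<close>,
  whose last argument only rescales the variable.
\<close>

definition hypergeo :: "complex list \<Rightarrow> complex list \<Rightarrow> complex \<Rightarrow> complex" where
  "hypergeo as cs z = eval_fps (fps_hypergeo as cs 1) z"

lemma hypergeo_altdef:
  "hypergeo as cs z =
     (\<Sum>k. (\<Prod>a\<leftarrow>as. pochhammer a k) / ((\<Prod>c\<leftarrow>cs. pochhammer c k) * fact k) * z ^ k)"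
proof -
  have "foldl (\<lambda>r a. r * pochhammer a k) r xs = r * (\<Prod>a\<leftarrow>xs. pochhammer a k)"
    for xs :: "complex list" and r k
    by (induction xs arbitrary: r) (simp_all add: mult_ac)
  then show ?thesis
    by (simp add: hypergeo_def eval_fps_def)
qed

text \<open>
  The Gauss function on \<open>\<complex> - [1,\<infinity>)\<close>: the domain is open and connected and contains the unit
  disc, so the values there do not depend on the choice of the holomorphic extension. On
  \<open>[1,\<infinity>)\<close> the value is unspecified.
\<close>

definition hyp2F1 :: "complex \<Rightarrow> complex \<Rightarrow> complex \<Rightarrow> complex \<Rightarrow> complex" where
  "hyp2F1 a b c = (SOME f. f holomorphic_on (- (complex_of_real ` {1..})) \<and>
                           (\<forall>z\<in>ball 0 1. f z = hypergeo [a, b] [c] z))"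

text \<open>
  Summing the double series over \<open>n\<close> first and using \<open>(\<gamma>)\<^bsub>m+n\<^esub> = (\<gamma>)\<^sub>m (\<gamma> + m)\<^sub>n\<close> gives the
  following, which is the analytic continuation in \<open>v\<close>.
\<close>

definition appell_F3 ::
  "complex \<Rightarrow> complex \<Rightarrow> complex \<Rightarrow> complex \<Rightarrow> complex \<Rightarrow> complex \<Rightarrow> complex \<Rightarrow> complex" where
  "appell_F3 \<alpha> \<alpha>' \<beta> \<beta>' \<gamma> u v =
     (\<Sum>m. pochhammer \<alpha> m * pochhammer \<beta> m / (pochhammer \<gamma> m * fact m) * u ^ m *
          hyp2F1 \<alpha>' \<beta>' (\<gamma> + of_nat m) v)"

definition msm_integrand ::
  "complex \<Rightarrow> complex \<Rightarrow> complex \<Rightarrow> complex \<Rightarrow> complex \<Rightarrow> (real \<Rightarrow> complex) \<Rightarrow> real \<Rightarrow> real \<Rightarrow> complex"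
  where
  "msm_integrand \<alpha> \<alpha>' \<beta> \<beta>' \<gamma> f x t =
     complex_of_real (x - t) powr (\<gamma> - 1) * complex_of_real t powr (- \<alpha>') *
     appell_F3 \<alpha> \<alpha>' \<beta> \<beta>' \<gamma> (complex_of_real (1 - t / x)) (complex_of_real (1 - x / t)) * f t"

definition msm_integral ::
  "complex \<Rightarrow> complex \<Rightarrow> complex \<Rightarrow> complex \<Rightarrow> complex \<Rightarrow> (real \<Rightarrow> complex) \<Rightarrow> real \<Rightarrow> complex"
  where
  "msm_integral \<alpha> \<alpha>' \<beta> \<beta>' \<gamma> f x =
     complex_of_real x powr (- \<alpha>) / Gamma \<gamma> *
     (LBINT t:{0<..<x}. msm_integrand \<alpha> \<alpha>' \<beta> \<beta>' \<gamma> f x t)"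

definition gen_bessel :: "complex \<Rightarrow> complex \<Rightarrow> complex \<Rightarrow> complex \<Rightarrow> complex" where
  "gen_bessel p b c z =
     (\<Sum>k. (-1) ^ k * c ^ k / (Gamma (p + (b + 1) / 2 + of_nat k) * fact k) *
          (z / 2) powr (2 * of_nat k + p))"

end

theory Submission
  imports Defs "HOL-Complex_Analysis.Complex_Analysis" "HOL-Real_Asymp.Real_Asymp"
begin

text \<open>
  The Bessel function is a power series, and the operator maps powers to powers: for
  \<open>Re \<gamma> > 0\<close> and \<open>Re \<rho>\<close>, \<open>Re (\<rho> + \<beta>' - \<alpha>')\<close>, \<open>Re (\<rho> + \<gamma> - \<alpha> - \<alpha>' - \<beta>)\<close> positive, the image of
  \<open>t powr (\<rho> - 1)\<close> is a constant (\<open>power_image\<close>, a quotient of six Gamma values) times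
  \<open>x powr (\<rho> - \<alpha> - \<alpha>' + \<gamma> - 1)\<close>. Putting \<open>\<rho> + p + 2k\<close> for \<open>\<rho>\<close> and summing over \<open>k\<close> turns each of the
  six Gamma values into a Pochhammer symbol of order \<open>2k\<close>; the duplication formula splits it into two
  symbols of order \<open>k\<close>, which are the upper and lower parameters of the final series. This outer
  interchange is harmless, because the Bessel coefficients decay faster than any geometric sequence.

  For a power function and \<open>x = 1\<close>, expand \<open>F3\<close> in powers of \<open>1 - t\<close>. The \<open>m\<close>-th term is the
  integral of \<open>t powr (r - 1) * (1 - t) powr (c - 1) * 2F1(\<alpha>', \<beta>'; c; 1 - 1/t)\<close> over the unit interval,
  where \<open>c = \<gamma> + m\<close> and \<open>r = \<rho> - \<alpha>'\<close>. Pfaff's transformation replaces the Gauss function by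
  \<open>t powr \<alpha>' * 2F1(\<alpha>', c - \<beta>'; c; 1 - t)\<close>; termwise Beta integrals and Gauss's theorem for the value at
  \<open>1\<close> then give Gamma quotients (\<open>hyp2F1_beta_transform\<close>), and the sum over \<open>m\<close> is once more a Gauss
  series at \<open>1\<close> (\<open>msm_power_unit\<close>).

  The interchange of this sum with the integral is the delicate point. After Pfaff's transformation the double
  series need not converge absolutely when \<open>\<alpha>'\<close> and \<open>\<beta>'\<close> both have negative real part, so the
  integrals of absolute values are estimated through
  \<open>\<bar>2F1(a, b; c + m; -y)\<bar> \<le> C (1 + y / (m + 1)) powr K\<close>, uniformly in \<open>m\<close>, for every
  \<open>K > max (- Re a) (- Re b)\<close> (\<open>hyp2F1_uniform_upper\<close>). The factor \<open>(1 - t) powr m\<close> confines the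
  \<open>m\<close>-th integral to \<open>t\<close> of order \<open>1/m\<close>, where \<open>y = 1/t - 1\<close> is of order \<open>m\<close>; so the bound
  yields the true order \<open>(m + 1) powr (- Re r)\<close> of the \<open>m\<close>-th integral, and the resulting series
  converges under the stated conditions on the real parts.

  Three facts about the Gauss function hold for all \<open>a\<close>, \<open>b\<close> and \<open>Re c > 0\<close>: existence of
  the continuation to the slit plane, Pfaff's transformation, and the uniform bound. Euler's integral gives each of
  them when \<open>Re b > 1\<close> and \<open>Re c > Re b + 1\<close>. Two contiguous relations raise \<open>b\<close> and \<open>c - b\<close>
  by one, with coefficients that have no pole for \<open>Re c > 0\<close>, and all three facts are inherited along them;
  \<open>hypergeo_parameter_induct\<close> is this induction.
\<close>

section \<open>Growth of Pochhammer symbols and of the reciprocal Gamma function\<close>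

text \<open>
  Gauss's product formula for the reciprocal Gamma function. Powers of \<open>n + 1\<close> instead of \<open>n\<close> make
  the bounds derived from it meaningful for \<open>n = 0\<close> as well.
\<close>

lemma pochhammer_ratio_tendsto:
  "(\<lambda>n. cmod (pochhammer z n) / (fact n * (real n + 1) powr (Re z - 1))) \<longlonglongrightarrow> cmod (rGamma z)"
proof -
  have "(\<lambda>n. cmod (rGamma_series z n) *
              (real n powr Re z / ((real n + 1) * (real n + 2) powr (Re z - 1))))
          \<longlonglongrightarrow> cmod (rGamma z) * 1"
  proof (intro tendsto_mult tendsto_norm rGamma_series_LIMSEQ)
    show "(\<lambda>n. real n powr Re z / ((real n + 1) * (real n + 2) powr (Re z - 1))) \<longlonglongrightarrow> 1"
      by real_asymp
  qed
  moreover have "eventually (\<lambda>n. cmod (rGamma_series z n) *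
              (real n powr Re z / ((real n + 1) * (real n + 2) powr (Re z - 1))) =
        cmod (pochhammer z (Suc n)) / (fact (Suc n) * (real (Suc n) + 1) powr (Re z - 1))) sequentially"
    using eventually_gt_at_top[of 0]
  proof eventually_elim
    case (elim n)
    have "cmod (exp (z * complex_of_real (ln (real n)))) = real n powr Re z"
      using elim by (simp add: powr_def)
    then show ?case using elim
      by (simp add: rGamma_series_def norm_mult norm_divide divide_simps add_ac)
  qed
  ultimately have "(\<lambda>n. cmod (pochhammer z (Suc n)) / (fact (Suc n) * (real (Suc n) + 1) powr (Re z - 1)))
      \<longlonglongrightarrow> cmod (rGamma z)"
    by (simp add: tendsto_cong)
  then show ?thesis by (rule LIMSEQ_imp_Suc)
qed

lemma pochhammer_upper:
  obtains C where "C > 0"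
    "\<And>n. cmod (pochhammer z n) \<le> C * (fact n * (real n + 1) powr (Re z - 1))"
proof -
  have "Bseq (\<lambda>n. cmod (pochhammer z n) / (fact n * (real n + 1) powr (Re z - 1)))"
    using pochhammer_ratio_tendsto by (rule convergentI[THEN convergent_imp_Bseq])
  then obtain C where "C > 0"
    "\<And>n. norm (cmod (pochhammer z n) / (fact n * (real n + 1) powr (Re z - 1))) \<le> C"
    by (auto simp: Bseq_def)
  then show ?thesis by (intro that[of C]) (auto simp: field_simps)
qed

lemma pochhammer_lower:
  assumes "z \<notin> \<int>\<^sub>\<le>\<^sub>0"
  obtains C where "C > 0"
    "\<And>n. fact n * (real n + 1) powr (Re z - 1) \<le> C * cmod (pochhammer z n)"
proof -
  have "(\<lambda>n. inverse (cmod (pochhammer z n) / (fact n * (real n + 1) powr (Re z - 1)))) \<longlonglongrightarrow>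
          inverse (cmod (rGamma z))"
    using assms by (intro tendsto_inverse pochhammer_ratio_tendsto) (simp add: rGamma_eq_zero_iff)
  then have "Bseq (\<lambda>n. inverse (cmod (pochhammer z n) / (fact n * (real n + 1) powr (Re z - 1))))"
    by (rule convergentI[THEN convergent_imp_Bseq])
  then obtain C where C: "C > 0"
    "\<And>n. norm (inverse (cmod (pochhammer z n) / (fact n * (real n + 1) powr (Re z - 1)))) \<le> C"
    by (auto simp: Bseq_def)
  have "pochhammer z n \<noteq> 0" for n
    using assms by (auto simp: pochhammer_eq_0_iff)
  then have "fact n * (real n + 1) powr (Re z - 1) \<le> C * cmod (pochhammer z n)" for n
    using C(2)[of n] by (simp add: field_simps)
  then show ?thesis using C(1) by (intro that[of C]) auto
qed

lemma not_nonpos_Int_if_Re_pos: "Re z > 0 \<Longrightarrow> z \<notin> \<int>\<^sub>\<le>\<^sub>0"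
  by (auto elim!: nonpos_Ints_cases)

text \<open>
  For \<open>Re z > 0\<close> the value is \<open>rGamma z / pochhammer z n\<close>. The recursion
  \<open>rGamma z = z * rGamma (z + 1)\<close> costs one factor of order \<open>n + 1\<close> and carries the bound to all
  \<open>z\<close>, including the poles of \<open>Gamma\<close>, where the Pochhammer symbols vanish eventually.
\<close>

lemma rGamma_upper:
  obtains C where "C > 0"
    "\<And>n. cmod (rGamma (z + of_nat n)) \<le> C * ((real n + 1) powr (1 - Re z) / fact n)"
proof -
  define P where "P z \<longleftrightarrow> (\<exists>C>0. \<forall>n. cmod (rGamma (z + of_nat n)) \<le>
        C * ((real n + 1) powr (1 - Re z) / fact n))" for z
  have pos: "P z" if "Re z > 0" for z
  proof -
    have z: "z \<notin> \<int>\<^sub>\<le>\<^sub>0" using that by (rule not_nonpos_Int_if_Re_pos)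
    from pochhammer_lower[OF z] obtain C where C: "C > 0"
      "\<And>n. fact n * (real n + 1) powr (Re z - 1) \<le> C * cmod (pochhammer z n)" by blast
    have nz: "pochhammer z n \<noteq> 0" for n using z by (auto simp: pochhammer_eq_0_iff)
    have "cmod (rGamma (z + of_nat n)) \<le>
            (C * cmod (rGamma z)) * ((real n + 1) powr (1 - Re z) / fact n)" for n
    proof -
      have "cmod (rGamma (z + of_nat n)) = cmod (rGamma z) / cmod (pochhammer z n)"
        using pochhammer_rGamma[of z n] nz[of n] by (simp add: norm_mult)
      also have "\<dots> \<le> cmod (rGamma z) * (C / (fact n * (real n + 1) powr (Re z - 1)))"
      proof -
        have "1 / cmod (pochhammer z n) \<le> C / (fact n * (real n + 1) powr (Re z - 1))"
          using C(2)[of n] nz[of n] by (simp add: field_simps)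
        from mult_left_mono[OF this, of "cmod (rGamma z)"] show ?thesis by simp
      qed
      also have "\<dots> = (C * cmod (rGamma z)) * ((real n + 1) powr (1 - Re z) / fact n)"
        by (simp add: powr_diff field_simps)
      finally show ?thesis .
    qed
    moreover have "C * cmod (rGamma z) > 0" using C(1) z by (simp add: rGamma_eq_zero_iff)
    ultimately show ?thesis unfolding P_def by blast
  qed
  have step: "P z" if "P (z + 1)" for z
  proof -
    from that obtain C where C: "C > 0" "\<And>n. cmod (rGamma (z + 1 + of_nat n)) \<le>
        C * ((real n + 1) powr (1 - Re (z + 1)) / fact n)" unfolding P_def by blast
    have "cmod (rGamma (z + of_nat n)) \<le>
            (C * (cmod z + 1)) * ((real n + 1) powr (1 - Re z) / fact n)" for n
    proof -
      have "rGamma (z + of_nat n) = (z + of_nat n) * rGamma (z + 1 + of_nat n)"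
        using rGamma_plus1[of "z + of_nat n"] by (simp add: add_ac)
      then have "cmod (rGamma (z + of_nat n)) = cmod (z + of_nat n) * cmod (rGamma (z + 1 + of_nat n))"
        by (simp add: norm_mult)
      also have "\<dots> \<le> ((cmod z + 1) * (real n + 1)) * (C * ((real n + 1) powr (1 - Re (z + 1)) / fact n))"
      proof (intro mult_mono C(2))
        have "cmod (z + of_nat n) \<le> cmod z + real n" using norm_triangle_ineq[of z "of_nat n"] by simp
        also have "\<dots> \<le> (cmod z + 1) * (real n + 1)" by (simp add: algebra_simps)
        finally show "cmod (z + of_nat n) \<le> (cmod z + 1) * (real n + 1)" .
      qed auto
      also have "\<dots> = (C * (cmod z + 1)) * ((real n + 1) powr (1 - Re z) / fact n)"
        by (simp add: powr_diff powr_minus field_simps)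
      finally show ?thesis .
    qed
    moreover have "C * (cmod z + 1) > 0" using C(1) by (simp add: add_nonneg_pos)
    ultimately show ?thesis unfolding P_def by blast
  qed
  have "P (z + of_nat k) \<Longrightarrow> P z" for k
  proof (induction k)
    case (Suc k)
    then show ?case using step[of "z + of_nat k"] by (simp add: add.assoc add.commute[of 1])
  qed simp
  moreover obtain k where "real k > - Re z" using reals_Archimedean2 by blast
  then have "P (z + of_nat k)" by (intro pos) auto
  ultimately have "P z" by blast
  then show ?thesis using that unfolding P_def by blast
qed

lemma summable_Suc_powr:
  assumes "p < -1"
  shows "summable (\<lambda>n. (real n + 1) powr p)"
proof -
  have "summable (\<lambda>n. real (Suc n) powr p)"
    using assms by (subst summable_Suc_iff) (simp add: summable_real_powr_iff)
  then show ?thesis by (simp add: add_ac)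
qed

lemma summable_Suc_powr_power:
  assumes "0 \<le> r" "r < 1"
  shows "summable (\<lambda>n. (real n + 1) powr p * r ^ n)"
proof (cases "r = 0")
  case True
  have "summable (\<lambda>n. (real n + 1) powr p * 0 ^ n)"
    by (rule summable_finite[of "{0}"]) auto
  then show ?thesis using True by simp
next
  case False
  then have r: "0 < r" using assms by simp
  have "(\<lambda>n. (real n + 1) powr p * r ^ n) \<in> O(\<lambda>n. 1 / (real n ^ 2))"
    using r assms(2) by real_asymp
  moreover have "summable (\<lambda>n. norm (1 / (real n ^ 2)))"
    using inverse_power_summable[of 2, where 'a = real] by (simp add: field_simps)
  ultimately show ?thesis by (rule summable_comparison_test_bigo[rotated])
qed

definition gauss_coeff :: "complex \<Rightarrow> complex \<Rightarrow> complex \<Rightarrow> nat \<Rightarrow> complex" where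
  "gauss_coeff a b c n = pochhammer a n * pochhammer b n / (pochhammer c n * fact n)"

lemma gauss_coeff_upper:
  assumes "c \<notin> \<int>\<^sub>\<le>\<^sub>0"
  obtains C where "C > 0"
    "\<And>n. cmod (gauss_coeff a b c n) \<le> C * (real n + 1) powr (Re (a + b - c) - 1)"
proof -
  from pochhammer_upper[of a] obtain A where A: "A > 0"
    "\<And>n. cmod (pochhammer a n) \<le> A * (fact n * (real n + 1) powr (Re a - 1))" by blast
  from pochhammer_upper[of b] obtain B where B: "B > 0"
    "\<And>n. cmod (pochhammer b n) \<le> B * (fact n * (real n + 1) powr (Re b - 1))" by blast
  from pochhammer_lower[OF assms] obtain D where D: "D > 0"
    "\<And>n. fact n * (real n + 1) powr (Re c - 1) \<le> D * cmod (pochhammer c n)" by blast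
  have "cmod (gauss_coeff a b c n) \<le> (A * B * D) * (real n + 1) powr (Re (a + b - c) - 1)" for n
  proof -
    have nz: "cmod (pochhammer c n) > 0" using assms by (auto simp: pochhammer_eq_0_iff)
    have inv: "1 / cmod (pochhammer c n) \<le> D / (fact n * (real n + 1) powr (Re c - 1))"
      using D(2)[of n] nz by (simp add: field_simps)
    have "cmod (gauss_coeff a b c n) =
        cmod (pochhammer a n) * cmod (pochhammer b n) * (1 / cmod (pochhammer c n)) / fact n"
      by (simp add: gauss_coeff_def norm_mult norm_divide)
    also have "\<dots> \<le> (A * (fact n * (real n + 1) powr (Re a - 1))) *
       (B * (fact n * (real n + 1) powr (Re b - 1))) * (D / (fact n * (real n + 1) powr (Re c - 1))) / fact n"
      using A B D inv by (intro divide_right_mono mult_mono) (auto intro!: mult_nonneg_nonneg)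
    also have "\<dots> = (A * B * D) * (real n + 1) powr (Re (a + b - c) - 1)"
    proof -
      have *: "(A * (f * N powr (Re a - 1))) * (B * (f * N powr (Re b - 1))) *
              (D / (f * N powr (Re c - 1))) / f = (A * B * D) * N powr (Re (a + b - c) - 1)"
        if "N > 0" "f > 0" for N f :: real
        using that by (simp add: powr_diff powr_add field_simps)
      show ?thesis using *[of "real n + 1" "fact n"] by simp
    qed
    finally show ?thesis .
  qed
  with A(1) B(1) D(1) show ?thesis by (intro that[of "A * B * D"]) auto
qed

lemma summable_gauss_coeff_at_1:
  assumes "c \<notin> \<int>\<^sub>\<le>\<^sub>0" "Re (c - a - b) > 0"
  shows "summable (\<lambda>n. cmod (gauss_coeff a b c n))"
proof -
  from gauss_coeff_upper[OF assms(1)] obtain C where C: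
    "\<And>n. cmod (gauss_coeff a b c n) \<le> C * (real n + 1) powr (Re (a + b - c) - 1)" by blast
  show ?thesis
    by (rule summable_comparison_test'[OF summable_mult[OF summable_Suc_powr]])
       (use C assms(2) in auto)
qed

lemma summable_gauss_coeff:
  assumes "c \<notin> \<int>\<^sub>\<le>\<^sub>0" "cmod z < 1"
  shows "summable (\<lambda>n. cmod (gauss_coeff a b c n * z ^ n))"
proof -
  from gauss_coeff_upper[OF assms(1)] obtain C where C:
    "\<And>n. cmod (gauss_coeff a b c n) \<le> C * (real n + 1) powr (Re (a + b - c) - 1)" by blast
  show ?thesis
  proof (rule summable_comparison_test'[OF summable_mult[OF summable_Suc_powr_power]])
    show "norm (cmod (gauss_coeff a b c n * z ^ n)) \<le>
       C * ((real n + 1) powr (Re (a + b - c) - 1) * cmod z ^ n)" for n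
      using mult_right_mono[OF C, of "cmod z ^ n" n] by (simp add: norm_mult norm_power mult_ac)
  qed (use assms in auto)
qed

section \<open>Gauss's summation theorem\<close>

text \<open>
  The terms are at most of order \<open>n powr (- Re (c - a - b) - 1)\<close>. The second claim is the vanishing boundary term of
  the telescoping sum in \<open>gauss_sum_shift\<close>.
\<close>

lemma gauss_sum_aux:
  assumes "Re (c - a - b) > 0"
  shows "summable (\<lambda>n. cmod (pochhammer a n * pochhammer b n * rGamma (c + of_nat n) / fact n))"
    and "(\<lambda>n. pochhammer a n * pochhammer b n * rGamma (c + of_nat n) / fact n * of_nat n) \<longlonglongrightarrow> 0"
proof -
  from pochhammer_upper[of a] obtain A where A: "A > 0"
    "\<And>n. cmod (pochhammer a n) \<le> A * (fact n * (real n + 1) powr (Re a - 1))" by blast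
  from pochhammer_upper[of b] obtain B where B: "B > 0"
    "\<And>n. cmod (pochhammer b n) \<le> B * (fact n * (real n + 1) powr (Re b - 1))" by blast
  from rGamma_upper[of c] obtain D where D: "D > 0"
    "\<And>n. cmod (rGamma (c + of_nat n)) \<le> D * ((real n + 1) powr (1 - Re c) / fact n)" by blast
  have bound: "cmod (pochhammer a n * pochhammer b n * rGamma (c + of_nat n) / fact n) \<le>
          (A * B * D) * (real n + 1) powr (- Re (c - a - b) - 1)" for n
  proof -
    have "cmod (pochhammer a n * pochhammer b n * rGamma (c + of_nat n) / fact n) =
        cmod (pochhammer a n) * cmod (pochhammer b n) * cmod (rGamma (c + of_nat n)) / fact n"
      by (simp add: norm_mult norm_divide)
    also have "\<dots> \<le> (A * (fact n * (real n + 1) powr (Re a - 1))) *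
       (B * (fact n * (real n + 1) powr (Re b - 1))) * (D * ((real n + 1) powr (1 - Re c) / fact n)) / fact n"
      using A B D by (intro divide_right_mono mult_mono) (auto intro!: mult_nonneg_nonneg)
    also have "\<dots> = (A * B * D) * (real n + 1) powr (- Re (c - a - b) - 1)"
    proof -
      have *: "(A * (f * N powr (Re a - 1))) * (B * (f * N powr (Re b - 1))) *
              (D * (N powr (1 - Re c) / f)) / f = (A * B * D) * N powr (- Re (c - a - b) - 1)"
        if "N > 0" "f > 0" for N f :: real
        using that by (simp add: powr_diff powr_add powr_minus field_simps)
      show ?thesis using *[of "real n + 1" "fact n"] by simp
    qed
    finally show ?thesis .
  qed
  show "summable (\<lambda>n. cmod (pochhammer a n * pochhammer b n * rGamma (c + of_nat n) / fact n))"
    by (rule summable_comparison_test'[OF summable_mult[OF summable_Suc_powr]])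
       (use bound assms in auto)
  show "(\<lambda>n. pochhammer a n * pochhammer b n * rGamma (c + of_nat n) / fact n * of_nat n) \<longlonglongrightarrow> 0"
  proof (rule Lim_null_comparison)
    show "\<forall>\<^sub>F n in sequentially. cmod (pochhammer a n * pochhammer b n * rGamma (c + of_nat n) / fact n * of_nat n)
            \<le> (A * B * D) * (real n + 1) powr (- Re (c - a - b))"
    proof (intro always_eventually allI)
      fix n
      have "cmod (pochhammer a n * pochhammer b n * rGamma (c + of_nat n) / fact n * of_nat n)
          \<le> ((A * B * D) * (real n + 1) powr (- Re (c - a - b) - 1)) * (real n + 1)"
        unfolding norm_mult[of "_ / _"] using A B D by (intro mult_mono bound) auto
      also have "\<dots> = (A * B * D) * (real n + 1) powr (- Re (c - a - b))"
        by (simp add: powr_diff)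
      finally show "cmod (pochhammer a n * pochhammer b n * rGamma (c + of_nat n) / fact n * of_nat n)
            \<le> (A * B * D) * (real n + 1) powr (- Re (c - a - b))" .
    qed
    have "(\<lambda>n. (real n + 1) powr (- Re (c - a - b))) \<longlonglongrightarrow> 0" using assms
      by real_asymp
    from tendsto_mult_left[OF this] show "(\<lambda>n. (A * B * D) * (real n + 1) powr (- Re (c - a - b))) \<longlonglongrightarrow> 0"
      by simp
  qed
qed

text \<open>
  \<open>2F1(a, b; c; 1) / Gamma c\<close>. Using \<open>rGamma (c + n)\<close> in place of \<open>1 / (c)\<^sub>n\<close> keeps the sum
  meaningful when \<open>c\<close> is a nonpositive integer.
\<close>

definition gauss_sum :: "complex \<Rightarrow> complex \<Rightarrow> complex \<Rightarrow> complex" where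
  "gauss_sum a b c = (\<Sum>n. pochhammer a n * pochhammer b n * rGamma (c + of_nat n) / fact n)"

text \<open>
  With \<open>t c n\<close> for the summand, \<open>(c - a - b) t c n - (c - a) (c - b) t (c + 1) n\<close> is the difference of
  consecutive values of \<open>n * t c n\<close>.
\<close>

lemma gauss_sum_shift:
  assumes "Re (c - a - b) > 0"
  shows "(c - a - b) * gauss_sum a b c = (c - a) * (c - b) * gauss_sum a b (c + 1)"
proof -
  define t where "t c n = pochhammer a n * pochhammer b n * rGamma (c + of_nat n) / fact n" for c n
  define G where "G n = t c n * of_nat n" for n
  have "summable (t c)" "summable (t (c + 1))"
    unfolding t_def using assms
    by (auto intro!: gauss_sum_aux(1)[THEN summable_norm_cancel])
  then have "(\<lambda>n. (c - a - b) * t c n - (c - a) * (c - b) * t (c + 1) n) sums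
     ((c - a - b) * gauss_sum a b c - (c - a) * (c - b) * gauss_sum a b (c + 1))"
    unfolding gauss_sum_def t_def by (intro sums_diff sums_mult summable_sums)
  moreover have "(\<lambda>n. G n - G (Suc n)) sums (G 0 - 0)"
    by (intro telescope_sums') (use gauss_sum_aux(2)[OF assms] in \<open>simp add: G_def t_def\<close>)
  moreover have "(c - a - b) * t c n - (c - a) * (c - b) * t (c + 1) n = G n - G (Suc n)" for n
  proof -
    define R where "R = rGamma (c + of_nat n + 1)"
    define q where "q = pochhammer a n * pochhammer b n / fact n"
    have R: "rGamma (c + of_nat n) = (c + of_nat n) * R"
      using rGamma_plus1[of "c + of_nat n"] by (simp add: R_def)
    have R': "rGamma (c + 1 + of_nat n) = R" "rGamma (c + (1 + of_nat n)) = R"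
      "rGamma (1 + (c + of_nat n)) = R"
      by (simp_all add: R_def add_ac)
    have G1: "G (Suc n) = q * (a + of_nat n) * (b + of_nat n) * R"
      by (simp add: G_def t_def pochhammer_Suc q_def R' divide_simps del: of_nat_Suc)
         (simp add: algebra_simps R')
    have t: "t c n = q * (c + of_nat n) * R" "t (c + 1) n = q * R"
      by (simp_all add: t_def q_def R R')
    show ?thesis
      unfolding G1 unfolding G_def t by (simp add: algebra_simps)
  qed
  ultimately show ?thesis
    by (auto dest: sums_unique2 simp: G_def)
qed

text \<open>
  Shifting \<open>c\<close> by \<open>N\<close> enlarges every factor of \<open>(c)\<^sub>n\<close> in modulus, and the first one at
  least to \<open>Re c + N\<close>; hence all terms but the zeroth contribute \<open>O(1 / N)\<close>.
\<close>

lemma gauss_sum_limit: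
  assumes "Re c > 0" "Re (c - a - b) > 0"
  shows "(\<lambda>N. gauss_sum a b (c + of_nat N) / rGamma (c + of_nat N)) \<longlonglongrightarrow> 1"
proof -
  define S where "S = (\<Sum>n. cmod (gauss_coeff a b c n))"
  have c: "c \<notin> \<int>\<^sub>\<le>\<^sub>0" using assms by (intro not_nonpos_Int_if_Re_pos)
  have bound: "cmod (gauss_sum a b (c + of_nat N) / rGamma (c + of_nat N) - 1) \<le> cmod c * S / (Re c + real N)" for N
  proof -
    define d where "d = c + of_nat N"
    have d: "d \<notin> \<int>\<^sub>\<le>\<^sub>0" using assms by (intro not_nonpos_Int_if_Re_pos) (auto simp: d_def)
    have d0: "d \<noteq> 0" "c \<noteq> 0" using d c by auto
    have tm: "pochhammer a n * pochhammer b n * rGamma (d + of_nat n) / fact n / rGamma d = gauss_coeff a b d n" for n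
    proof -
      have "rGamma d \<noteq> 0" using d by (simp add: rGamma_eq_zero_iff)
      moreover from this have "pochhammer d n \<noteq> 0" "rGamma (d + of_nat n) \<noteq> 0"
        using pochhammer_rGamma[of d n] by auto
      ultimately show ?thesis
        using pochhammer_rGamma[of d n] by (simp add: gauss_coeff_def field_simps)
    qed
    have sd: "summable (\<lambda>n. cmod (gauss_coeff a b d n))"
      using assms by (intro summable_gauss_coeff_at_1 d) (auto simp: d_def)
    have sc: "summable (\<lambda>n. cmod (gauss_coeff a b c n))"
      using assms by (intro summable_gauss_coeff_at_1 c)
    have "gauss_sum a b d / rGamma d = (\<Sum>n. gauss_coeff a b d n)"
    proof -
      have "Re (d - a - b) > 0" using assms by (simp add: d_def)
      from suminf_divide[OF summable_norm_cancel[OF gauss_sum_aux(1)[OF this]], of "rGamma d"]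
      show ?thesis unfolding gauss_sum_def by (simp only: tm)
    qed
    also have "\<dots> = 1 + (\<Sum>n. gauss_coeff a b d (Suc n))"
      using suminf_split_head[OF summable_norm_cancel[OF sd]] by (simp add: gauss_coeff_def)
    finally have "cmod (gauss_sum a b d / rGamma d - 1) = cmod (\<Sum>n. gauss_coeff a b d (Suc n))"
      by simp
    also have "\<dots> \<le> (\<Sum>n. cmod (gauss_coeff a b d (Suc n)))"
      using sd by (intro summable_norm) (subst summable_Suc_iff)
    also have "\<dots> \<le> (\<Sum>n. cmod c / cmod d * cmod (gauss_coeff a b c (Suc n)))"
    proof (intro suminf_le summable_mult)
      fix n
      have "cmod (pochhammer (c + 1) n) \<le> cmod (pochhammer (d + 1) n)"
        unfolding pochhammer_prod prod_norm[symmetric]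
      proof (intro prod_mono conjI norm_ge_zero)
        fix i
        show "cmod (c + 1 + of_nat i) \<le> cmod (d + 1 + of_nat i)"
          unfolding norm_complex_def d_def using assms(1)
          by (auto intro!: real_sqrt_le_mono add_right_mono power_mono)
      qed
      moreover have "pochhammer (c + 1) n \<noteq> 0"
        using not_nonpos_Int_if_Re_pos[of "c + 1"] assms(1) by (auto simp: pochhammer_eq_0_iff)
      ultimately have le: "1 / cmod (pochhammer (d + 1) n) \<le> 1 / cmod (pochhammer (c + 1) n)"
        by (intro divide_left_mono mult_pos_pos) (auto intro: order.strict_trans2)
      have "cmod (gauss_coeff a b d (Suc n)) =
          cmod (pochhammer a (Suc n)) * cmod (pochhammer b (Suc n)) / fact (Suc n) / cmod d * (1 / cmod (pochhammer (d + 1) n))"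
        by (simp add: gauss_coeff_def norm_mult norm_divide pochhammer_rec[of d] del: fact_Suc)
      also have "\<dots> \<le> cmod (pochhammer a (Suc n)) * cmod (pochhammer b (Suc n)) / fact (Suc n) / cmod d * (1 / cmod (pochhammer (c + 1) n))"
        by (intro mult_left_mono le) (simp del: fact_Suc)
      also have "\<dots> = cmod c / cmod d * cmod (gauss_coeff a b c (Suc n))"
        using d0 by (simp add: gauss_coeff_def norm_mult norm_divide pochhammer_rec[of c] del: fact_Suc)
      finally show "cmod (gauss_coeff a b d (Suc n)) \<le> cmod c / cmod d * cmod (gauss_coeff a b c (Suc n))" .
    qed (rule iffD2[OF summable_Suc_iff sd], rule iffD2[OF summable_Suc_iff sc])
    also have "\<dots> = cmod c / cmod d * (\<Sum>n. cmod (gauss_coeff a b c (Suc n)))"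
      by (rule suminf_mult) (rule iffD2[OF summable_Suc_iff sc])
    also have "\<dots> \<le> cmod c / cmod d * S"
      using suminf_split_head[OF sc] by (intro mult_left_mono) (simp_all add: S_def)
    also have "cmod c / cmod d * S \<le> cmod c / (Re c + real N) * S"
    proof (intro mult_right_mono divide_left_mono)
      show "Re c + real N \<le> cmod d" using complex_Re_le_cmod[of d] by (simp add: d_def)
      show "0 \<le> S" using sc by (auto simp: S_def intro!: suminf_nonneg)
    qed (use assms d0 in auto)
    finally show ?thesis by (simp add: d_def)
  qed
  have "(\<lambda>N. gauss_sum a b (c + of_nat N) / rGamma (c + of_nat N) - 1) \<longlonglongrightarrow> 0"
  proof (rule Lim_null_comparison[OF always_eventually[OF allI[OF bound]]])
    show "(\<lambda>N. cmod c * S / (Re c + real N)) \<longlonglongrightarrow> 0" by real_asymp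
  qed
  then show ?thesis by (simp add: LIM_zero_iff)
qed

text \<open>
  Gauss's theorem. For \<open>Re c > 0\<close> one iterates \<open>gauss_sum_shift\<close>: the accumulated factors are
  quotients of Pochhammer symbols, whose limit is given by the product formula for \<open>rGamma\<close>, and the
  remaining series tends to its zeroth term. Since both sides obey the same recursion in \<open>c\<close>, the formula
  descends to arbitrary \<open>c\<close>.
\<close>

theorem gauss_summation:
  assumes "Re (c - a - b) > 0"
  shows "(\<lambda>n. pochhammer a n * pochhammer b n * rGamma (c + of_nat n) / fact n) sums
           (Gamma (c - a - b) * rGamma (c - a) * rGamma (c - b))"
proof -
  define T where "T c = Gamma (c - a - b) * rGamma (c - a) * rGamma (c - b)" for c
  have iter: "gauss_sum a b c * pochhammer (c - a - b) N =
          pochhammer (c - a) N * pochhammer (c - b) N * gauss_sum a b (c + of_nat N)"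
    if "Re (c - a - b) > 0" for c N
  proof (induction N)
    case (Suc N)
    have "(c + of_nat N - a - b) * gauss_sum a b (c + of_nat N) =
          (c + of_nat N - a) * (c + of_nat N - b) * gauss_sum a b (c + of_nat N + 1)"
      using that by (intro gauss_sum_shift) auto
    then have *: "(c - a - b + of_nat N) * gauss_sum a b (c + of_nat N) =
          (c - a + of_nat N) * (c - b + of_nat N) * gauss_sum a b (c + of_nat (Suc N))"
      by (simp add: algebra_simps)
    have "gauss_sum a b c * pochhammer (c - a - b) (Suc N) =
            (gauss_sum a b c * pochhammer (c - a - b) N) * (c - a - b + of_nat N)"
      by (simp add: pochhammer_Suc)
    also have "\<dots> = pochhammer (c - a) N * pochhammer (c - b) N *
         ((c - a - b + of_nat N) * gauss_sum a b (c + of_nat N))"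
      by (simp add: Suc)
    finally show ?case unfolding * by (simp add: pochhammer_Suc mult_ac)
  qed simp
  \<comment> \<open>The exponentials in the four factors \<open>rGamma_series\<close> cancel, so the product below does not depend on \<open>N\<close>.\<close>
  have pos: "gauss_sum a b c = T c" if c: "Re c > 0" "Re (c - a - b) > 0" for c
  proof -
    have nz: "c \<notin> \<int>\<^sub>\<le>\<^sub>0" "c - a - b \<notin> \<int>\<^sub>\<le>\<^sub>0" using c by (auto intro!: not_nonpos_Int_if_Re_pos)
    have nz': "pochhammer (c - a - b) n \<noteq> 0" "pochhammer c n \<noteq> 0" for n
      using nz by (auto simp: pochhammer_eq_0_iff)
    have rc: "rGamma c \<noteq> 0" using nz by (simp add: rGamma_eq_zero_iff)
    have "(\<lambda>N. rGamma_series (c - a) N * rGamma_series (c - b) N / (rGamma_series (c - a - b) N * rGamma_series c N) *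
            (gauss_sum a b (c + of_nat (Suc N)) / rGamma (c + of_nat (Suc N))))
            \<longlonglongrightarrow> rGamma (c - a) * rGamma (c - b) / (rGamma (c - a - b) * rGamma c) * 1"
      using nz by (intro tendsto_intros LIMSEQ_Suc[OF gauss_sum_limit[OF c]]) (simp add: rGamma_eq_zero_iff)
    moreover have "rGamma_series (c - a) N * rGamma_series (c - b) N / (rGamma_series (c - a - b) N * rGamma_series c N) *
            (gauss_sum a b (c + of_nat (Suc N)) / rGamma (c + of_nat (Suc N))) = gauss_sum a b c / rGamma c" for N
    proof -
      define E where "E z = exp (z * complex_of_real (ln (of_nat N)))" for z
      have E: "E (c - a) * E (c - b) = E (c - a - b) * E c"
        unfolding E_def exp_add[symmetric] by (simp add: algebra_simps)
      have E0: "E z \<noteq> 0" for z by (simp add: E_def)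
      have "rGamma_series (c - a) N * rGamma_series (c - b) N / (rGamma_series (c - a - b) N * rGamma_series c N)
          = pochhammer (c - a) (Suc N) * pochhammer (c - b) (Suc N) / (pochhammer (c - a - b) (Suc N) * pochhammer c (Suc N))
            * ((E (c - a - b) * E c) / (E (c - a) * E (c - b)))"
        unfolding rGamma_series_def E_def[symmetric] by (simp add: field_simps E0)
      also have "\<dots> = pochhammer (c - a) (Suc N) * pochhammer (c - b) (Suc N) / (pochhammer (c - a - b) (Suc N) * pochhammer c (Suc N))"
        by (simp add: E E0)
      also have "\<dots> * (gauss_sum a b (c + of_nat (Suc N)) / rGamma (c + of_nat (Suc N))) =
          (gauss_sum a b c * pochhammer (c - a - b) (Suc N)) / (pochhammer (c - a - b) (Suc N) * (pochhammer c (Suc N) * rGamma (c + of_nat (Suc N))))"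
        unfolding iter[OF c(2)] by simp
      also have "\<dots> = gauss_sum a b c / rGamma c"
        using nz' pochhammer_rGamma[of c "Suc N"] by simp
      finally show ?thesis .
    qed
    ultimately have "(\<lambda>N::nat. gauss_sum a b c / rGamma c)
            \<longlonglongrightarrow> rGamma (c - a) * rGamma (c - b) / (rGamma (c - a - b) * rGamma c)"
      by simp
    then have "gauss_sum a b c / rGamma c = rGamma (c - a) * rGamma (c - b) / (rGamma (c - a - b) * rGamma c)"
      by (simp add: LIMSEQ_const_iff)
    then show ?thesis using rc by (simp add: T_def Gamma_def field_simps)
  qed
  have T_shift: "(c - a - b) * T c = (c - a) * (c - b) * T (c + 1)" if "Re (c - a - b) > 0" for c
  proof -
    have "Gamma (c + 1 - a - b) = (c - a - b) * Gamma (c - a - b)"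
      using Gamma_plus1[OF not_nonpos_Int_if_Re_pos[OF that]] by (simp add: algebra_simps)
    moreover have "rGamma (c - a) = (c - a) * rGamma (c + 1 - a)" "rGamma (c - b) = (c - b) * rGamma (c + 1 - b)"
      using rGamma_plus1[of "c - a"] rGamma_plus1[of "c - b"] by (simp_all add: algebra_simps)
    ultimately show ?thesis by (simp add: T_def mult_ac)
  qed
  have "Re c + real k > 0 \<Longrightarrow> Re (c - a - b) > 0 \<Longrightarrow> gauss_sum a b c = T c" for k c
  proof (induction k arbitrary: c)
    case 0
    then show ?case by (intro pos) auto
  next
    case (Suc k)
    have "gauss_sum a b (c + 1) = T (c + 1)" using Suc.prems by (intro Suc.IH) auto
    then have "(c - a - b) * gauss_sum a b c = (c - a - b) * T c"
      using gauss_sum_shift[OF Suc.prems(2)] T_shift[OF Suc.prems(2)] by simp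
    moreover have "c - a - b \<noteq> 0" using Suc.prems(2) by auto
    ultimately show ?case by simp
  qed
  note pos' = this
  obtain k where "real k > - Re c" using reals_Archimedean2 by blast
  then have "gauss_sum a b c = T c" using assms by (intro pos'[of c k]) auto
  then show ?thesis
    using summable_sums[OF summable_norm_cancel[OF gauss_sum_aux(1)[OF assms]]]
    by (simp add: T_def gauss_sum_def)
qed

section \<open>Termwise integration and complex Beta integrals\<close>

lemma cmod_of_real_powr: "t > 0 \<Longrightarrow> cmod (complex_of_real t powr z) = t powr Re z"
  by (subst norm_powr_real_powr) auto

text \<open>
  Every interchange of a series with an integral below is an instance of this dominated form.
\<close>

lemma set_integral_suminf:
  fixes f :: "nat \<Rightarrow> real \<Rightarrow> complex"
  assumes int: "\<And>i. set_integrable lborel S (f i)"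
    and sm: "\<And>x. x \<in> S \<Longrightarrow> summable (\<lambda>i. cmod (f i x))"
    and bd: "\<And>i. (LBINT x:S. cmod (f i x)) \<le> B i" "summable B"
  shows "set_integrable lborel S (\<lambda>x. \<Sum>i. f i x)"
    and "(\<lambda>i. LBINT x:S. f i x) sums (LBINT x:S. \<Sum>i. f i x)"
proof -
  let ?g = "\<lambda>i x. indicat_real S x *\<^sub>R f i x"
  have eq: "(\<Sum>i. ?g i x) = indicat_real S x *\<^sub>R (\<Sum>i. f i x)" for x
    by (auto simp: indicator_def)
  have norm_eq: "norm (?g i x) = indicat_real S x *\<^sub>R cmod (f i x)" for i x
    by (simp add: indicator_def)
  have 1: "integrable lborel (?g i)" for i using int by (simp add: set_integrable_def)
  have 2: "AE x in lborel. summable (\<lambda>i. norm (?g i x))"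
    using sm by (intro always_eventually allI) (auto simp: indicator_def)
  have "0 \<le> (\<integral>x. norm (?g i x) \<partial>lborel)" for i by simp
  then have 3: "summable (\<lambda>i. \<integral>x. norm (?g i x) \<partial>lborel)"
    by (intro summable_comparison_test'[OF bd(2)]) (use bd(1) in \<open>auto simp: norm_eq set_lebesgue_integral_def\<close>)
  show "set_integrable lborel S (\<lambda>x. \<Sum>i. f i x)"
    using integrable_suminf[OF 1 2 3] by (simp add: eq set_integrable_def)
  show "(\<lambda>i. LBINT x:S. f i x) sums (LBINT x:S. \<Sum>i. f i x)"
    using sums_integral[OF 1 2 3] by (simp add: eq set_lebesgue_integral_def)
qed

lemma set_integrable_norm_bound:
  fixes f :: "real \<Rightarrow> complex" and g :: "real \<Rightarrow> real"
  assumes "set_integrable lborel S g" "continuous_on S f" "S \<in> sets borel"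
    and "\<And>x. x \<in> S \<Longrightarrow> cmod (f x) \<le> g x"
  shows "set_integrable lborel S f" "(LBINT x:S. cmod (f x)) \<le> (LBINT x:S. g x)"
proof -
  have "(\<lambda>x. indicator S x *\<^sub>R f x) \<in> borel_measurable borel"
    using assms by (intro borel_measurable_continuous_on_indicator) auto
  then show 1: "set_integrable lborel S f"
    unfolding set_integrable_def
    by (intro Bochner_Integration.integrable_bound[OF assms(1)[unfolded set_integrable_def]])
       (use assms(4) in \<open>force simp: indicator_def\<close>)+
  show "(LBINT x:S. cmod (f x)) \<le> (LBINT x:S. g x)"
    by (intro set_integral_mono set_integrable_norm 1 assms)
qed

lemma beta_integral_real:
  assumes "x > 0" "y > (0::real)"
  shows "set_integrable lborel {0<..<1} (\<lambda>t. t powr (x - 1) * (1 - t) powr (y - 1))"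
    and "(LBINT t:{0<..<1}. t powr (x - 1) * (1 - t) powr (y - 1)) = Beta x y"
proof -
  show 1: "set_integrable lborel {0<..<1} (\<lambda>t. t powr (x - 1) * (1 - t) powr (y - 1))"
    by (rule set_integrable_subset[OF integrable_Beta[OF assms]]) auto
  have "((\<lambda>t. t powr (x - 1) * (1 - t) powr (y - 1)) has_integral Beta x y) {0<..<1}"
    using has_integral_Beta_real[OF assms] by (simp add: has_integral_Icc_iff_Ioo)
  then show "(LBINT t:{0<..<1}. t powr (x - 1) * (1 - t) powr (y - 1)) = Beta x y"
    using set_borel_integral_eq_integral(2)[OF 1] by (simp add: integral_unique)
qed

lemma beta_kernel_cmod:
  assumes "t \<in> {0<..<1}"
  shows "cmod (complex_of_real t powr a * complex_of_real (1 - t) powr b) = t powr Re a * (1 - t) powr Re b"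
  using assms by (simp only: norm_mult cmod_of_real_powr greaterThanLessThan_iff diff_gt_0_iff_gt)

lemma continuous_on_beta_kernel:
  "continuous_on {0<..<1} (\<lambda>t. complex_of_real t powr a * complex_of_real (1 - t) powr b)"
  by (intro continuous_intros) auto

lemma integrable_beta_kernel:
  assumes "Re a > 0" "Re b > 0"
  shows "set_integrable lborel {0<..<1}
          (\<lambda>t. complex_of_real t powr (a - 1) * complex_of_real (1 - t) powr (b - 1))"
    and "(LBINT t:{0<..<1}. cmod (complex_of_real t powr (a - 1) * complex_of_real (1 - t) powr (b - 1)))
            = Beta (Re a) (Re b)"
proof -
  show "set_integrable lborel {0<..<1}
          (\<lambda>t. complex_of_real t powr (a - 1) * complex_of_real (1 - t) powr (b - 1))"
    by (rule set_integrable_norm_bound(1)[OF beta_integral_real(1)[OF assms] continuous_on_beta_kernel])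
       (auto simp: beta_kernel_cmod simp del: of_real_diff)
  show "(LBINT t:{0<..<1}. cmod (complex_of_real t powr (a - 1) * complex_of_real (1 - t) powr (b - 1)))
            = Beta (Re a) (Re b)"
    unfolding beta_integral_real(2)[OF assms, symmetric]
    by (intro set_lebesgue_integral_cong) (auto simp: beta_kernel_cmod simp del: of_real_diff)
qed

lemma binomial_series_pochhammer:
  assumes "cmod w < 1"
  shows "(\<lambda>n. pochhammer a n / fact n * w ^ n) sums (1 - w) powr (- a)"
proof -
  have "(\<lambda>n. ((- a) gchoose n) * (- w) ^ n) sums (1 + (- w)) powr (- a)"
    by (rule gen_binomial_complex) (use assms in simp)
  also have "(\<lambda>n. ((- a) gchoose n) * (- w) ^ n) = (\<lambda>n. pochhammer a n / fact n * w ^ n)"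
  proof
    fix n
    show "((- a) gchoose n) * (- w) ^ n = pochhammer a n / fact n * w ^ n"
      unfolding power_minus[of w n] by (simp add: gbinomial_pochhammer)
  qed
  finally show ?thesis by simp
qed

lemma power_integral_0_1:
  assumes "Re a > 0"
  shows "set_integrable lborel {0<..<1} (\<lambda>t. complex_of_real t powr (a - 1))"
    and "(LBINT t:{0<..<1}. complex_of_real t powr (a - 1)) = 1 / a"
    and "(LBINT t:{0<..<1}. cmod (complex_of_real t powr (a - 1))) = 1 / Re a"
proof -
  have eq: "complex_of_real t powr (a - 1) * complex_of_real (1 - t) powr (1 - 1) = complex_of_real t powr (a - 1)"
    if "t \<in> {0<..<1}" for t using that by (simp add: complex_eq_iff)
  note int = integrable_beta_kernel[OF assms, of 1]
  have "set_integrable lborel {0<..<1} (\<lambda>t. complex_of_real t powr (a - 1)) =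
     set_integrable lborel {0<..<1} (\<lambda>t. complex_of_real t powr (a - 1) * complex_of_real (1 - t) powr (1 - 1))"
    by (intro set_integrable_cong) (simp_all only: eq)
  then show 1: "set_integrable lborel {0<..<1} (\<lambda>t. complex_of_real t powr (a - 1))"
    using int(1) by simp
  have "(LBINT t:{0<..<1}. cmod (complex_of_real t powr (a - 1))) = Beta (Re a) (Re 1)"
    by (subst int(2)[symmetric], simp, intro set_lebesgue_integral_cong) (use eq in auto)
  also have "\<dots> = 1 / Re a"
  proof -
    have "Re a \<notin> \<int>\<^sub>\<le>\<^sub>0" using assms by (auto elim!: nonpos_Ints_cases)
    from Gamma_plus1[OF this] show ?thesis
      using assms Gamma_real_pos[OF assms] by (simp add: Beta_def del: Gamma_real_pos)
  qed
  finally show "(LBINT t:{0<..<1}. cmod (complex_of_real t powr (a - 1))) = 1 / Re a" .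
  have "((\<lambda>t. complex_of_real t powr (a - 1)) has_integral
            (of_real 1 powr a / a - of_real 0 powr a / a)) {0..1}" using assms
      by (intro fundamental_theorem_of_calculus_interior)
         (auto intro!: continuous_intros derivative_eq_intros has_vector_derivative_real_field)
  then have "((\<lambda>t. complex_of_real t powr (a - 1)) has_integral (1 / a)) {0<..<1}"
    using assms by (simp add: has_integral_Icc_iff_Ioo)
  then show "(LBINT t:{0<..<1}. complex_of_real t powr (a - 1)) = 1 / a"
    using set_borel_integral_eq_integral(2)[OF 1] by (simp add: integral_unique)
qed

text \<open>
  Expand \<open>(1 - t) powr (b - 1)\<close> by the binomial series and integrate termwise; the resulting series is
  \<open>2F1(1 - b, a; a + 1; 1) / a\<close>, which Gauss's theorem evaluates.
\<close>

lemma beta_integral_complex: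
  assumes "Re a > 0" "Re b > 0"
  shows "(LBINT t:{0<..<1}. complex_of_real t powr (a - 1) * complex_of_real (1 - t) powr (b - 1)) =
           Gamma a * Gamma b * rGamma (a + b)"
proof -
  define h where "h n = pochhammer (1 - b) n / fact n" for n
  define f where "f n t = h n * complex_of_real t powr (a + of_nat n - 1)" for n t
  from pochhammer_upper[of "1 - b"] obtain C where C: "C > 0"
    "\<And>n. cmod (pochhammer (1 - b) n) \<le> C * (fact n * (real n + 1) powr (Re (1 - b) - 1))" by blast
  have pos: "Re (a + of_nat n) > 0" for n using assms by (simp add: add_pos_nonneg)
  have fsum: "(\<lambda>n. f n t) sums (complex_of_real t powr (a - 1) * complex_of_real (1 - t) powr (b - 1))"
    and fsm: "summable (\<lambda>n. cmod (f n t))" if t: "t \<in> {0<..<1}" for t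
  proof -
    have f: "f n t = complex_of_real t powr (a - 1) * (h n * complex_of_real t ^ n)" for n
      using t powr_add[of "complex_of_real t" "a - 1" "of_nat n"] by (simp add: f_def algebra_simps)
    show "(\<lambda>n. f n t) sums (complex_of_real t powr (a - 1) * complex_of_real (1 - t) powr (b - 1))"
      unfolding f using binomial_series_pochhammer[of "complex_of_real t" "1 - b"] t
      by (intro sums_mult) (simp add: h_def)
    have "summable (\<lambda>n. cmod (gauss_coeff (1 - b) 1 1 n * complex_of_real t ^ n))"
      using t by (intro summable_gauss_coeff) auto
    also have "(\<lambda>n. cmod (gauss_coeff (1 - b) 1 1 n * complex_of_real t ^ n)) = (\<lambda>n. cmod (h n * complex_of_real t ^ n))"
      by (simp add: gauss_coeff_def h_def pochhammer_fact[symmetric] fun_eq_iff)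
    finally show "summable (\<lambda>n. cmod (f n t))"
      unfolding f norm_mult[of "_ powr _"] by (rule summable_mult)
  qed
  \<comment> \<open>\<open>m * (n + 1)\<close> bounds \<open>Re a + n\<close> from below for every \<open>n\<close>.\<close>
  define m where "m = min (Re a) 1"
  have m: "m > 0" using assms by (simp add: m_def)
  have bd: "(LBINT t:{0<..<1}. cmod (f n t)) \<le> C / m * (real n + 1) powr (- Re b - 1)" for n
  proof -
    have "(LBINT t:{0<..<1}. cmod (f n t)) = cmod (h n) * (1 / Re (a + of_nat n))"
      unfolding f_def norm_mult set_integral_mult_right power_integral_0_1(3)[OF pos] ..
    also have "\<dots> \<le> (C * (real n + 1) powr (- Re b)) * (1 / (m * (real n + 1)))"
    proof (intro mult_mono divide_left_mono mult_pos_pos pos)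
      show "cmod (h n) \<le> C * (real n + 1) powr (- Re b)"
        using C(2)[of n] by (simp add: h_def norm_divide field_simps)
      have "m * real n \<le> 1 * real n" by (intro mult_right_mono) (auto simp: m_def)
      then show "m * (real n + 1) \<le> Re (a + of_nat n)" by (simp add: algebra_simps m_def)
    qed (use C m pos[of n] in auto)
    also have "\<dots> = C / m * (real n + 1) powr (- Re b - 1)"
      by (simp add: powr_diff)
    finally show ?thesis .
  qed
  have sums1: "(\<lambda>n. LBINT t:{0<..<1}. f n t) sums
      (LBINT t:{0<..<1}. (\<Sum>n. f n t))"
  proof (rule set_integral_suminf(2)[OF _ fsm bd])
    show "set_integrable lborel {0<..<1} (f n)" for n
      unfolding f_def by (intro set_integrable_mult_right power_integral_0_1(1) pos)
    show "summable (\<lambda>n. C / m * (real n + 1) powr (- Re b - 1))"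
      using assms by (intro summable_mult summable_Suc_powr) auto
  qed auto
  have "(LBINT t:{0<..<1}. (\<Sum>n. f n t)) =
     (LBINT t:{0<..<1}. complex_of_real t powr (a - 1) * complex_of_real (1 - t) powr (b - 1))"
    by (intro set_lebesgue_integral_cong) (use fsum in \<open>auto simp: sums_iff\<close>)
  moreover have "(LBINT t:{0<..<1}. f n t) = h n * (1 / (a + of_nat n))" for n
    unfolding f_def set_integral_mult_right power_integral_0_1(2)[OF pos] ..
  ultimately have 1: "(\<lambda>n. h n * (1 / (a + of_nat n))) sums
     (LBINT t:{0<..<1}. complex_of_real t powr (a - 1) * complex_of_real (1 - t) powr (b - 1))"
    using sums1 by simp
  have "(\<lambda>n. pochhammer (1 - b) n * pochhammer a n * rGamma (a + 1 + of_nat n) / fact n) sums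
           (Gamma (a + 1 - (1 - b) - a) * rGamma (a + 1 - (1 - b)) * rGamma (a + 1 - a))"
    using assms by (intro gauss_summation) auto
  moreover have "pochhammer (1 - b) n * pochhammer a n * rGamma (a + 1 + of_nat n) / fact n =
                   rGamma a * (h n * (1 / (a + of_nat n)))" for n
  proof -
    have "a + of_nat n \<noteq> 0" using pos[of n] by (metis less_irrefl zero_complex.sel(1))
    then have "rGamma (a + 1 + of_nat n) = rGamma (a + of_nat n) / (a + of_nat n)"
      using rGamma_plus1[of "a + of_nat n"] by (simp add: field_simps)
    then show ?thesis by (simp add: pochhammer_rGamma[of a n] h_def mult_ac)
  qed
  ultimately have "(\<lambda>n. rGamma a * (h n * (1 / (a + of_nat n)))) sums (Gamma b * rGamma (a + b))"
    by (simp add: algebra_simps)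
  with sums_mult[OF 1, of "rGamma a"] have
    "rGamma a * (LBINT t:{0<..<1}. complex_of_real t powr (a - 1) * complex_of_real (1 - t) powr (b - 1))
       = Gamma b * rGamma (a + b)"
    by (rule sums_unique2)
  note main = this
  have one: "Gamma a * rGamma a = 1"
    using not_nonpos_Int_if_Re_pos[OF assms(1)] by (simp add: Gamma_def rGamma_eq_zero_iff)
  show ?thesis
    using arg_cong[OF main, of "\<lambda>u. Gamma a * u"] one
    unfolding mult.assoc[symmetric] by (simp del: of_real_diff)
qed

section \<open>Contiguous relations and reduction of the parameters\<close>

lemma hypergeo_2F1: "hypergeo [a, b] [c] z = (\<Sum>n. gauss_coeff a b c n * z ^ n)"
  by (simp add: hypergeo_altdef gauss_coeff_def)

lemma suminf_shift_relation:
  fixes f g h :: "nat \<Rightarrow> complex"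
  assumes "summable (\<lambda>n. cmod (f n * z ^ n))" "summable (\<lambda>n. cmod (g n * z ^ n))" "summable (\<lambda>n. cmod (h n * z ^ n))"
    and "f 0 = g 0" "\<And>n. f (Suc n) = g (Suc n) + k * h n"
  shows "(\<Sum>n. f n * z ^ n) = (\<Sum>n. g n * z ^ n) + k * z * (\<Sum>n. h n * z ^ n)"
proof -
  note s = assms(1-3)[THEN summable_norm_cancel]
  have "(\<Sum>n. f n * z ^ n) = f 0 + (\<Sum>n. f (Suc n) * z ^ Suc n)"
    using suminf_split_head[OF s(1)] by simp
  also have "(\<lambda>n. f (Suc n) * z ^ Suc n) = (\<lambda>n. g (Suc n) * z ^ Suc n + k * z * (h n * z ^ n))"
    by (simp add: assms(5) algebra_simps)
  also have "(\<Sum>n. g (Suc n) * z ^ Suc n + k * z * (h n * z ^ n)) =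
       (\<Sum>n. g (Suc n) * z ^ Suc n) + k * z * (\<Sum>n. h n * z ^ n)"
    using s(2,3) by (subst suminf_add[symmetric])
       (auto intro!: summable_mult iffD2[OF summable_Suc_iff, of "\<lambda>n. g n * z ^ n"] simp: suminf_mult simp del: power_Suc)
  finally show ?thesis
    using suminf_split_head[OF s(2)] by (simp add: assms(4))
qed

lemma gauss_coeff_0 [simp]: "gauss_coeff a b c 0 = 1"
  by (simp add: gauss_coeff_def)

lemma pochhammer_succ_shift:
  fixes z :: complex
  shows "pochhammer z (Suc n) = z * pochhammer (z + 1) n"
    and "pochhammer (z + 1) (Suc n) = pochhammer (z + 1) n * (z + 1 + of_nat n)"
  by (rule pochhammer_rec, rule pochhammer_Suc)

lemma Re_pos_add_nat: "Re c > 0 \<Longrightarrow> c + of_nat n \<noteq> 0"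
  by (auto simp: complex_eq_iff)

lemma pochhammer_shift2:
  fixes c :: complex
  shows "(c + 1) * pochhammer (c + 2) n = pochhammer (c + 1) n * (c + 1 + of_nat n)"
  using pochhammer_rec[of "c + 1" n] pochhammer_Suc[of "c + 1" n] by (simp add: add.assoc)

lemma gauss_coeff_contiguous:
  assumes "Re c > 0"
  shows "gauss_coeff a b c (Suc n) =
           gauss_coeff a b (c + 1) (Suc n) + a * b / (c * (c + 1)) * gauss_coeff (a + 1) (b + 1) (c + 2) n"
    and "gauss_coeff a b c (Suc n) =
           gauss_coeff a (b + 1) c (Suc n) + (- (a / c)) * gauss_coeff (a + 1) (b + 1) (c + 1) n"
    and "gauss_coeff a b c (Suc n) =
           gauss_coeff a (b + 1) (c + 1) (Suc n) + (- (a * (c - b) / (c * (c + 1)))) * gauss_coeff (a + 1) (b + 1) (c + 2) n"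
proof -
  define P Q R where "P = pochhammer (a + 1) n" "Q = pochhammer (b + 1) n" "R = pochhammer (c + 1) n"
  define N :: complex where "N = of_nat n"
  define f :: complex where "f = fact n"
  have nz: "c \<noteq> 0" "c + 1 \<noteq> 0" "c + 1 + N \<noteq> 0" "R \<noteq> 0" "f \<noteq> 0" "N + 1 \<noteq> 0"
  proof -
    show "R \<noteq> 0" using not_nonpos_Int_if_Re_pos[of "c + 1"] assms
      by (auto simp: P_Q_R_def pochhammer_eq_0_iff)
    show "N + 1 \<noteq> 0" unfolding N_def by (metis of_nat_Suc of_nat_eq_0_iff nat.distinct(1) add.commute)
  qed (use Re_pos_add_nat[of c 0] Re_pos_add_nat[of "c" 1] Re_pos_add_nat[of "c + 1" n] assms in
        \<open>auto simp: f_def N_def\<close>)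
  have S: "pochhammer (c + 2) n = R * (c + 1 + N) / (c + 1)"
    using pochhammer_shift2[of c n] nz by (simp add: P_Q_R_def N_def field_simps)
  have fs: "fact (Suc n) = (N + 1) * f" by (simp add: f_def N_def add.commute)
  note rw = gauss_coeff_def S fs P_Q_R_def[symmetric] f_def[symmetric] N_def[symmetric]
    pochhammer_succ_shift[of a] pochhammer_succ_shift[of b] pochhammer_succ_shift[of c]
  show "gauss_coeff a b c (Suc n) =
           gauss_coeff a b (c + 1) (Suc n) + a * b / (c * (c + 1)) * gauss_coeff (a + 1) (b + 1) (c + 2) n"
    unfolding rw using nz by (simp add: divide_simps) (simp add: algebra_simps)
  show "gauss_coeff a b c (Suc n) =
           gauss_coeff a (b + 1) c (Suc n) + (- (a / c)) * gauss_coeff (a + 1) (b + 1) (c + 1) n"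
    unfolding rw using nz by (simp add: divide_simps) (simp add: algebra_simps)
  show "gauss_coeff a b c (Suc n) =
           gauss_coeff a (b + 1) (c + 1) (Suc n) + (- (a * (c - b) / (c * (c + 1)))) * gauss_coeff (a + 1) (b + 1) (c + 2) n"
    unfolding rw using nz by (simp add: divide_simps) (simp add: algebra_simps)
qed

text \<open>
  The first relation raises \<open>c - b\<close>, the second raises \<open>b\<close>; neither has a pole for \<open>Re c > 0\<close>.
  The third is the form that the first one takes after \<open>b\<close> has been replaced by \<open>c - b\<close>, as
  happens in Pfaff's transformation.
\<close>

lemma hypergeo_contiguous:
  assumes "Re c > 0" "cmod z < 1"
  shows "hypergeo [a, b] [c] z = hypergeo [a, b] [c + 1] z +
            a * b / (c * (c + 1)) * z * hypergeo [a + 1, b + 1] [c + 2] z"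
    and "hypergeo [a, b] [c] z = hypergeo [a, b + 1] [c] z +
            (- (a / c)) * z * hypergeo [a + 1, b + 1] [c + 1] z"
    and "hypergeo [a, b] [c] z = hypergeo [a, b + 1] [c + 1] z +
            (- (a * (c - b) / (c * (c + 1)))) * z * hypergeo [a + 1, b + 1] [c + 2] z"
proof -
  have s: "summable (\<lambda>n. cmod (gauss_coeff a b (c + of_nat k) n * z ^ n))" for a b k
    using assms by (intro summable_gauss_coeff not_nonpos_Int_if_Re_pos) auto
  note s0 = s[of _ _ 0, simplified] and s1 = s[of _ _ 1, simplified] and s2 = s[of _ _ 2, simplified]
  note co = gauss_coeff_contiguous[OF assms(1)]
  show "hypergeo [a, b] [c] z = hypergeo [a, b] [c + 1] z +
            a * b / (c * (c + 1)) * z * hypergeo [a + 1, b + 1] [c + 2] z"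
    unfolding hypergeo_2F1 by (rule suminf_shift_relation[OF s0 s1 s2 _ co(1)]) simp
  show "hypergeo [a, b] [c] z = hypergeo [a, b + 1] [c] z +
            (- (a / c)) * z * hypergeo [a + 1, b + 1] [c + 1] z"
    unfolding hypergeo_2F1 by (rule suminf_shift_relation[OF s0 s0 s1 _ co(2)]) simp
  show "hypergeo [a, b] [c] z = hypergeo [a, b + 1] [c + 1] z +
            (- (a * (c - b) / (c * (c + 1)))) * z * hypergeo [a + 1, b + 1] [c + 2] z"
    unfolding hypergeo_2F1 by (rule suminf_shift_relation[OF s0 s1 s2 _ co(3)]) simp
qed

text \<open>
  Repeated use of the first contiguous relation enlarges \<open>c - b\<close> while \<open>b\<close> does not decrease, and
  the second one enlarges \<open>b\<close>, so every triple with \<open>Re c > 0\<close> reduces to the base region. There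
  the exponents in Euler's integral have positive real part.
\<close>

lemma hypergeo_parameter_induct [consumes 1, case_names base c_shift b_shift]:
  assumes "Re c > 0"
    and base: "\<And>a b c. Re b > 1 \<Longrightarrow> Re c > Re b + 1 \<Longrightarrow> P a b c"
    and c_shift: "\<And>a b c. Re c > 0 \<Longrightarrow> P a b (c + 1) \<Longrightarrow> P (a + 1) (b + 1) (c + 2) \<Longrightarrow> P a b c"
    and b_shift: "\<And>a b c. Re c > 0 \<Longrightarrow> P a (b + 1) c \<Longrightarrow> P (a + 1) (b + 1) (c + 1) \<Longrightarrow> P a b c"
  shows "P a b c"
proof -
  have b_pos: "Re c > 0 \<Longrightarrow> Re b > 1 \<Longrightarrow> Re c + real k > Re b + 1 \<Longrightarrow> P a b c" for k a b c
  proof (induction k arbitrary: a b c)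
    case 0
    then show ?case by (intro base) auto
  next
    case (Suc k)
    then show ?case by (intro c_shift[OF _ Suc.IH Suc.IH]) auto
  qed
  have *: "Re c > 0 \<Longrightarrow> Re b + real k > 1 \<Longrightarrow> P a b c" for k a b c
  proof (induction k arbitrary: a b c)
    case 0
    obtain j where "real j > Re b + 1 - Re c" using reals_Archimedean2 by blast
    with 0 show ?case by (intro b_pos[where k = j]) auto
  next
    case (Suc k)
    then show ?case by (intro b_shift[OF _ Suc.IH Suc.IH]) auto
  qed
  obtain k where "real k > 1 - Re b" using reals_Archimedean2 by blast
  with assms(1) show ?thesis by (intro *[where k = k]) auto
qed

section \<open>Euler's integral on the slit plane\<close>

abbreviation slit_plane :: "complex set" where
  "slit_plane \<equiv> - (complex_of_real ` {1..})"

lemma slit_plane_iff: "z \<in> slit_plane \<longleftrightarrow> Im z \<noteq> 0 \<or> Re z < 1"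
  by (auto simp: complex_eq_iff image_iff)

lemma open_slit_plane: "open slit_plane"
proof -
  have "slit_plane = - ({z. Im z = 0} \<inter> {z. Re z \<ge> 1})"
    by (auto simp: set_eq_iff slit_plane_iff simp del: Compl_iff)
  moreover have "closed ({z. Im z = 0} \<inter> {z. Re z \<ge> 1})"
    by (intro closed_Int closed_Collect_eq closed_Collect_le continuous_intros)
  ultimately show ?thesis by (simp only: open_Compl)
qed

lemma starlike_slit_plane: "starlike slit_plane"
  unfolding starlike_def
proof (intro bexI[of _ 0] ballI subsetI)
  fix z w assume z: "z \<in> slit_plane" and "w \<in> closed_segment 0 z"
  then obtain u where u: "0 \<le> u" "u \<le> 1" "w = u *\<^sub>R z"
    by (auto simp: closed_segment_def)
  have "Re w < 1" if "Im w = 0"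
  proof (cases "u = 0")
    case False
    with that u z have "Re z < 1" by (auto simp: slit_plane_iff simp del: Compl_iff)
    have "Re w = u * Re z" using u by simp
    also have "u * Re z < 1"
    proof (cases "Re z \<le> 0")
      case True
      then have "u * Re z \<le> 0" using u by (simp add: mult_nonneg_nonpos)
      then show ?thesis by simp
    next
      case False
      then have "u * Re z \<le> 1 * Re z" using u by (intro mult_right_mono) auto
      then show ?thesis using \<open>Re z < 1\<close> by simp
    qed
    finally show ?thesis .
  qed (use u in auto)
  then show "w \<in> slit_plane" by (auto simp: slit_plane_iff simp del: Compl_iff)
qed (simp add: slit_plane_iff del: Compl_iff)

lemma connected_slit_plane: "connected slit_plane"
  using starlike_slit_plane by (rule starlike_imp_connected)

lemma ball_subset_slit_plane: "ball 0 1 \<subseteq> slit_plane"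
proof
  fix z :: complex assume "z \<in> ball 0 1"
  then have "Re z < 1" using complex_Re_le_cmod[of z] by simp
  then show "z \<in> slit_plane" by (simp add: slit_plane_iff del: Compl_iff)
qed

lemma of_real_in_slit_plane: "x < 1 \<Longrightarrow> complex_of_real x \<in> slit_plane"
  by (simp add: slit_plane_iff del: Compl_iff)

definition euler_integral :: "complex \<Rightarrow> complex \<Rightarrow> complex \<Rightarrow> complex \<Rightarrow> complex" where
  "euler_integral a b d z = (LBINT s:{0<..<1}. complex_of_real s powr (b - 1) *
      complex_of_real (1 - s) powr (d - 1) * (1 - z * complex_of_real s) powr (- a))"

lemma one_minus_mult_notin_nonpos_Reals:
  assumes "z \<in> slit_plane" "0 \<le> s" "s \<le> 1"
  shows "1 - z * complex_of_real s \<notin> \<real>\<^sub>\<le>\<^sub>0"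
proof
  assume "1 - z * complex_of_real s \<in> \<real>\<^sub>\<le>\<^sub>0"
  then have *: "Im z * s = 0" "1 \<le> Re z * s" by (auto simp: complex_nonpos_Reals_iff)
  then have "Im z = 0" "s > 0" using assms by (auto intro!: order.not_eq_order_implies_strict)
  then have "Re z < 1" using assms(1) by (simp add: slit_plane_iff del: Compl_iff)
  then have "Re z * s < 1 * s" using \<open>s > 0\<close> by (intro mult_strict_right_mono)
  with * assms show False by simp
qed

lemma continuous_on_powr_slit:
  fixes f :: "'a :: topological_space \<Rightarrow> complex"
  assumes "continuous_on A f" "\<And>z. z \<in> A \<Longrightarrow> f z \<notin> \<real>\<^sub>\<le>\<^sub>0"
  shows "continuous_on A (\<lambda>z. f z powr a)"
proof -
  have "continuous_on A (\<lambda>z. exp (a * Ln (f z)))"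
    using assms by (intro continuous_intros)
  moreover have "f z \<noteq> 0" if "z \<in> A" for z using assms(2)[OF that] by auto
  ultimately show ?thesis
    by (subst continuous_on_cong[OF refl, where g = "\<lambda>z. exp (a * Ln (f z))"]) (auto simp: powr_def)
qed

text \<open>
  The lower bounds \<open>1\<close> make the kernel continuous on the closed unit interval, so that differentiation
  under the integral sign needs no domination argument.
\<close>

lemma euler_integral_holomorphic:
  assumes "Re b > 1" "Re d > 1"
  shows "euler_integral a b d holomorphic_on slit_plane"
proof -
  define k where "k s = complex_of_real s powr (b - 1) * complex_of_real (1 - s) powr (d - 1)" for s
  have ck: "continuous_on A (\<lambda>x. k (g x))" if "continuous_on A g" "g ` A \<subseteq> {0..1}" for A :: "(complex \<times> real) set" and g
    unfolding k_def using that assms by (intro continuous_intros) (auto simp: image_subset_iff)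
  have ck': "continuous_on {0..1} k"
    unfolding k_def using assms by (intro continuous_intros) auto
  define I where "I z = integral (cbox 0 1) (\<lambda>s. k s * (1 - z * complex_of_real s) powr (- a))" for z
  have eq: "euler_integral a b d z = I z" if "z \<in> slit_plane" for z
  proof -
    have c: "continuous_on {0..1} (\<lambda>s. k s * (1 - z * complex_of_real s) powr (- a))"
      using one_minus_mult_notin_nonpos_Reals[OF that]
      by (intro continuous_on_mult ck' continuous_on_powr_slit continuous_intros) auto
    have "set_integrable lborel {0<..<1} (\<lambda>s. k s * (1 - z * complex_of_real s) powr (- a))"
      by (rule set_integrable_subset[OF borel_integrable_atLeastAtMost'[OF c]]) auto
    from set_borel_integral_eq_integral(2)[OF this] show ?thesis
      by (simp add: euler_integral_def I_def k_def integral_open_interval_real)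
  qed
  have "I holomorphic_on slit_plane"
    unfolding holomorphic_on_open[OF open_slit_plane]
  proof
    fix z assume "z \<in> slit_plane"
    then obtain e where e: "e > 0" "ball z e \<subseteq> slit_plane"
      using open_slit_plane open_contains_ball by metis
    note ns = one_minus_mult_notin_nonpos_Reals[OF subsetD[OF e(2)]]
    have "I holomorphic_on ball z e"
      unfolding I_def
    proof (rule leibniz_rule_holomorphic)
      fix w s assume w: "w \<in> ball z e" "s \<in> cbox 0 (1::real)"
      show "((\<lambda>w. k s * (1 - w * complex_of_real s) powr (- a)) has_field_derivative
              k s * (a * complex_of_real s * (1 - w * complex_of_real s) powr (- a - 1))) (at w within ball z e)"
        using ns[OF w(1), of s] w(2) by (auto intro!: derivative_eq_intros)
    next
      fix w assume w: "w \<in> ball z e"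
      show "(\<lambda>s. k s * (1 - w * complex_of_real s) powr (- a)) integrable_on cbox 0 1"
        using ns[OF w] unfolding cbox_interval
        by (intro integrable_continuous_real continuous_on_mult ck' continuous_on_powr_slit continuous_intros) auto
    next
      show "continuous_on (ball z e \<times> cbox 0 1) (\<lambda>(w, s). k s * (a * complex_of_real s * (1 - w * complex_of_real s) powr (- a - 1)))"
        unfolding case_prod_unfold
        using ns by (intro continuous_on_mult ck continuous_on_powr_slit continuous_intros) auto
    qed auto
    then show "\<exists>f'. (I has_field_derivative f') (at z)"
      using e(1) by (auto simp: holomorphic_on_open)
  qed
  then show ?thesis by (rule holomorphic_transform) (simp only: eq)
qed

text \<open>
  Expand the last factor of Euler's integral binomially; each term is a Beta integral.
\<close>

lemma euler_integral_eq_hypergeo: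
  assumes "Re b > 0" "Re d > 0" "cmod z < 1"
  shows "euler_integral a b d z = Gamma b * Gamma d * rGamma (b + d) * hypergeo [a, b] [b + d] z"
proof -
  define h where "h n = pochhammer a n / fact n * z ^ n" for n
  define k where "k s = complex_of_real s powr (b - 1) * complex_of_real (1 - s) powr (d - 1)" for s
  define f where "f n s = h n * (complex_of_real s powr (b + of_nat n - 1) * complex_of_real (1 - s) powr (d - 1))" for n s
  have pos: "Re (b + of_nat n) > 0" for n using assms by (simp add: add_pos_nonneg)
  have f: "f n s = k s * (h n * complex_of_real s ^ n)" if "s \<in> {0<..<1}" for n s
    using that powr_add[of "complex_of_real s" "b - 1" "of_nat n"] by (simp add: f_def k_def algebra_simps)
  have "summable (\<lambda>n. cmod (gauss_coeff a 1 1 n * z ^ n))"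
    using assms by (intro summable_gauss_coeff) auto
  then have sh: "summable (\<lambda>n. cmod (h n))"
    by (simp add: gauss_coeff_def h_def pochhammer_fact[symmetric])
  have le: "cmod (f n s) \<le> cmod (h n) * cmod (k s)" if s: "s \<in> {0<..<1}" for n s
  proof -
    have "cmod (f n s) = cmod (h n) * cmod (k s) * s ^ n" using s by (simp add: f norm_mult norm_power)
    also have "\<dots> \<le> cmod (h n) * cmod (k s) * 1"
      using s by (intro mult_left_mono power_le_one) auto
    finally show ?thesis by simp
  qed
  have fsum: "(\<Sum>n. f n s) = k s * (1 - z * complex_of_real s) powr (- a)" if s: "s \<in> {0<..<1}" for s
  proof -
    have "cmod (z * complex_of_real s) \<le> cmod z * 1"
      unfolding norm_mult using s by (intro mult_left_mono) auto
    with assms(3) have "cmod (z * complex_of_real s) < 1" by simp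
    from binomial_series_pochhammer[OF this, of a]
    have "(\<lambda>n. h n * complex_of_real s ^ n) sums (1 - z * complex_of_real s) powr (- a)"
      by (simp add: h_def power_mult_distrib mult_ac)
    then show ?thesis unfolding f[OF s] by (intro sums_unique[symmetric] sums_mult)
  qed
  have ik: "set_integrable lborel {0<..<1} k"
    unfolding k_def by (rule integrable_beta_kernel(1)[OF assms(1,2)])
  have fi: "set_integrable lborel {0<..<1} (f n)" for n
    unfolding f_def by (intro set_integrable_mult_right integrable_beta_kernel(1) pos assms)
  have "(\<lambda>n. LBINT s:{0<..<1}. f n s) sums (LBINT s:{0<..<1}. (\<Sum>n. f n s))"
  proof (rule set_integral_suminf(2)[OF fi])
    show "summable (\<lambda>n. cmod (f n s))" if "s \<in> {0<..<1}" for s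
      by (rule summable_comparison_test'[OF summable_mult2[OF sh, of "cmod (k s)"]]) (use le[OF that] in simp)
    show "(LBINT s:{0<..<1}. cmod (f n s)) \<le> cmod (h n) * (LBINT s:{0<..<1}. cmod (k s))" for n
      unfolding set_integral_mult_right[symmetric]
      by (intro set_integral_mono set_integrable_norm fi set_integrable_mult_right ik le)
    show "summable (\<lambda>n. cmod (h n) * (LBINT s:{0<..<1}. cmod (k s)))"
      by (intro summable_mult2 sh)
  qed
  also have "(LBINT s:{0<..<1}. (\<Sum>n. f n s)) = euler_integral a b d z"
    unfolding euler_integral_def by (intro set_lebesgue_integral_cong) (auto simp: fsum k_def)
  finally have 1: "(\<lambda>n. LBINT s:{0<..<1}. f n s) sums euler_integral a b d z" .
  have "(LBINT s:{0<..<1}. f n s) = Gamma b * Gamma d * rGamma (b + d) * (gauss_coeff a b (b + d) n * z ^ n)" for n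
  proof -
    have "(LBINT s:{0<..<1}. f n s) = h n * (Gamma (b + of_nat n) * Gamma d * rGamma (b + of_nat n + d))"
      unfolding f_def set_integral_mult_right using pos assms by (subst beta_integral_complex) auto
    moreover have "Gamma (b + of_nat n) = pochhammer b n * Gamma b"
      using pochhammer_Gamma[OF not_nonpos_Int_if_Re_pos[OF assms(1)], of n]
            not_nonpos_Int_if_Re_pos[OF assms(1)] by (simp add: Gamma_eq_zero_iff)
    moreover have "rGamma (b + of_nat n + d) = rGamma (b + d) / pochhammer (b + d) n"
    proof -
      have "b + d \<notin> \<int>\<^sub>\<le>\<^sub>0" using assms by (intro not_nonpos_Int_if_Re_pos) auto
      then have "pochhammer (b + d) n \<noteq> 0" by (auto simp: pochhammer_eq_0_iff)
      then show ?thesis using pochhammer_rGamma[of "b + d" n] by (simp add: field_simps add_ac)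
    qed
    ultimately show ?thesis by (simp add: h_def gauss_coeff_def mult_ac)
  qed
  with 1 have "(\<lambda>n. Gamma b * Gamma d * rGamma (b + d) * (gauss_coeff a b (b + d) n * z ^ n)) sums euler_integral a b d z"
    by simp
  moreover have "summable (\<lambda>n. gauss_coeff a b (b + d) n * z ^ n)"
    using assms by (intro summable_norm_cancel[OF summable_gauss_coeff] not_nonpos_Int_if_Re_pos) auto
  ultimately show ?thesis
    unfolding hypergeo_2F1 by (simp add: sums_iff suminf_mult)
qed

lemma beta_constant_nonzero:
  assumes "Re b > 0" "Re d > 0"
  shows "Gamma b * Gamma d * rGamma (b + d) \<noteq> 0"
  using not_nonpos_Int_if_Re_pos[of b] not_nonpos_Int_if_Re_pos[of d] not_nonpos_Int_if_Re_pos[of "b + d"] assms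
  by (simp add: Gamma_eq_zero_iff rGamma_eq_zero_iff)

section \<open>Analytic continuation of the Gauss function\<close>

text \<open>
  Existence makes the choice in the definition of \<^const>\<open>hyp2F1\<close> meaningful. The contiguous relations
  express an extension for \<open>(a, b, c)\<close> through extensions for larger \<open>b\<close> or \<open>c\<close>.
\<close>

lemma hyp2F1_extension_exists:
  assumes "Re c > 0"
  shows "\<exists>f. f holomorphic_on slit_plane \<and> (\<forall>z\<in>ball 0 1. f z = hypergeo [a, b] [c] z)"
  using assms
proof (induction a b c rule: hypergeo_parameter_induct)
  case (base a b c)
  let ?B = "Gamma b * Gamma (c - b) * rGamma (b + (c - b))"
  have B: "?B \<noteq> 0" using base by (intro beta_constant_nonzero) auto
  have "(\<lambda>z. euler_integral a b (c - b) z / ?B) holomorphic_on slit_plane"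
    using base B by (intro holomorphic_intros euler_integral_holomorphic) auto
  moreover have "\<forall>z\<in>ball 0 1. euler_integral a b (c - b) z / ?B = hypergeo [a, b] [c] z"
    using base B euler_integral_eq_hypergeo[of b "c - b" _ a] by auto
  ultimately show ?case by blast
next
  case (c_shift a b c)
  then obtain f g where fg: "f holomorphic_on slit_plane" "\<forall>z\<in>ball 0 1. f z = hypergeo [a, b] [c + 1] z"
    "g holomorphic_on slit_plane" "\<forall>z\<in>ball 0 1. g z = hypergeo [a + 1, b + 1] [c + 2] z" by blast
  have "(\<lambda>z. f z + a * b / (c * (c + 1)) * z * g z) holomorphic_on slit_plane"
    using fg by (intro holomorphic_on_add holomorphic_on_mult holomorphic_on_const holomorphic_on_ident)
  moreover have "\<forall>z\<in>ball 0 1. f z + a * b / (c * (c + 1)) * z * g z = hypergeo [a, b] [c] z"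
    using fg hypergeo_contiguous(1)[OF c_shift(1), of _ a b] by simp
  ultimately show ?case by blast
next
  case (b_shift a b c)
  then obtain f g where fg: "f holomorphic_on slit_plane" "\<forall>z\<in>ball 0 1. f z = hypergeo [a, b + 1] [c] z"
    "g holomorphic_on slit_plane" "\<forall>z\<in>ball 0 1. g z = hypergeo [a + 1, b + 1] [c + 1] z" by blast
  have "(\<lambda>z. f z + (- (a / c)) * z * g z) holomorphic_on slit_plane"
    using fg by (intro holomorphic_on_add holomorphic_on_mult holomorphic_on_const holomorphic_on_ident)
  moreover have "\<forall>z\<in>ball 0 1. f z + (- (a / c)) * z * g z = hypergeo [a, b] [c] z"
    using fg hypergeo_contiguous(2)[OF b_shift(1), of _ a b] by simp
  ultimately show ?case by blast
qed

lemma
  assumes "Re c > 0"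
  shows hyp2F1_holomorphic: "hyp2F1 a b c holomorphic_on slit_plane"
    and hyp2F1_eq_hypergeo: "cmod z < 1 \<Longrightarrow> hyp2F1 a b c z = hypergeo [a, b] [c] z"
proof -
  have "hyp2F1 a b c holomorphic_on slit_plane \<and> (\<forall>z\<in>ball 0 1. hyp2F1 a b c z = hypergeo [a, b] [c] z)"
    unfolding hyp2F1_def by (rule someI_ex[OF hyp2F1_extension_exists[OF assms]])
  then show "hyp2F1 a b c holomorphic_on slit_plane" "cmod z < 1 \<Longrightarrow> hyp2F1 a b c z = hypergeo [a, b] [c] z"
    by auto
qed

lemma hyp2F1_eqI:
  assumes "Re c > 0" "f holomorphic_on slit_plane"
    and "\<And>z. cmod z < 1 \<Longrightarrow> f z = hypergeo [a, b] [c] z" "z \<in> slit_plane"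
  shows "hyp2F1 a b c z = f z"
proof (rule analytic_continuation_open[of "ball 0 1" slit_plane "hyp2F1 a b c" f])
  show "hyp2F1 a b c z = f z" if "z \<in> ball 0 1" for z
    using that assms by (simp add: hyp2F1_eq_hypergeo)
qed (use assms in \<open>auto simp del: Compl_iff intro: hyp2F1_holomorphic open_slit_plane
       connected_slit_plane ball_subset_slit_plane\<close>)

lemma hyp2F1_contiguous:
  assumes "Re c > 0" "z \<in> slit_plane"
  shows "hyp2F1 a b c z = hyp2F1 a b (c + 1) z +
            a * b / (c * (c + 1)) * z * hyp2F1 (a + 1) (b + 1) (c + 2) z"
    and "hyp2F1 a b c z = hyp2F1 a (b + 1) c z +
            (- (a / c)) * z * hyp2F1 (a + 1) (b + 1) (c + 1) z"
    and "hyp2F1 a b c z = hyp2F1 a (b + 1) (c + 1) z +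
            (- (a * (c - b) / (c * (c + 1)))) * z * hyp2F1 (a + 1) (b + 1) (c + 2) z"
proof -
  note hol = holomorphic_on_add holomorphic_on_mult holomorphic_on_const holomorphic_on_ident hyp2F1_holomorphic
  show "hyp2F1 a b c z = hyp2F1 a b (c + 1) z +
            a * b / (c * (c + 1)) * z * hyp2F1 (a + 1) (b + 1) (c + 2) z"
  proof (rule hyp2F1_eqI[OF assms(1) _ _ assms(2)])
    show "(\<lambda>z. hyp2F1 a b (c + 1) z +
            a * b / (c * (c + 1)) * z * hyp2F1 (a + 1) (b + 1) (c + 2) z) holomorphic_on slit_plane"
      by (intro hol) (use assms(1) in simp_all)
    fix z :: complex assume "cmod z < 1"
    with hypergeo_contiguous(1)[OF assms(1) this, of a b] assms(1)
    show "hyp2F1 a b (c + 1) z +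
            a * b / (c * (c + 1)) * z * hyp2F1 (a + 1) (b + 1) (c + 2) z = hypergeo [a, b] [c] z"
      by (simp add: hyp2F1_eq_hypergeo)
  qed
  show "hyp2F1 a b c z = hyp2F1 a (b + 1) c z +
            (- (a / c)) * z * hyp2F1 (a + 1) (b + 1) (c + 1) z"
  proof (rule hyp2F1_eqI[OF assms(1) _ _ assms(2)])
    show "(\<lambda>z. hyp2F1 a (b + 1) c z +
            (- (a / c)) * z * hyp2F1 (a + 1) (b + 1) (c + 1) z) holomorphic_on slit_plane"
      by (intro hol) (use assms(1) in simp_all)
    fix z :: complex assume "cmod z < 1"
    with hypergeo_contiguous(2)[OF assms(1) this, of a b] assms(1)
    show "hyp2F1 a (b + 1) c z +
            (- (a / c)) * z * hyp2F1 (a + 1) (b + 1) (c + 1) z = hypergeo [a, b] [c] z"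
      by (simp add: hyp2F1_eq_hypergeo)
  qed
  show "hyp2F1 a b c z = hyp2F1 a (b + 1) (c + 1) z +
            (- (a * (c - b) / (c * (c + 1)))) * z * hyp2F1 (a + 1) (b + 1) (c + 2) z"
  proof (rule hyp2F1_eqI[OF assms(1) _ _ assms(2)])
    show "(\<lambda>z. hyp2F1 a (b + 1) (c + 1) z +
            (- (a * (c - b) / (c * (c + 1)))) * z * hyp2F1 (a + 1) (b + 1) (c + 2) z) holomorphic_on slit_plane"
      by (intro hol) (use assms(1) in simp_all)
    fix z :: complex assume "cmod z < 1"
    with hypergeo_contiguous(3)[OF assms(1) this, of a b] assms(1)
    show "hyp2F1 a (b + 1) (c + 1) z +
            (- (a * (c - b) / (c * (c + 1)))) * z * hyp2F1 (a + 1) (b + 1) (c + 2) z = hypergeo [a, b] [c] z"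
      by (simp add: hyp2F1_eq_hypergeo)
  qed
qed

lemma hyp2F1_euler:
  assumes "Re b > 1" "Re c > Re b + 1" "z \<in> slit_plane"
  shows "hyp2F1 a b c z = euler_integral a b (c - b) z / (Gamma b * Gamma (c - b) * rGamma c)"
proof (rule hyp2F1_eqI[OF _ _ _ assms(3)])
  have B: "Gamma b * Gamma (c - b) * rGamma c \<noteq> 0"
    using beta_constant_nonzero[of b "c - b"] assms by simp
  show "(\<lambda>z. euler_integral a b (c - b) z / (Gamma b * Gamma (c - b) * rGamma c)) holomorphic_on slit_plane"
    using assms B by (intro holomorphic_intros euler_integral_holomorphic) auto
  show "euler_integral a b (c - b) z / (Gamma b * Gamma (c - b) * rGamma c) = hypergeo [a, b] [c] z" if "cmod z < 1" for z
    using euler_integral_eq_hypergeo[of b "c - b" z a] assms that B by simp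
qed (use assms in auto)

lemma set_integral_reflect_0_1:
  fixes f :: "real \<Rightarrow> complex"
  shows "(LBINT s:{0<..<1}. f s) = (LBINT s:{0<..<1}. f (1 - s))"
proof -
  have "(LBINT s:{0<..<1}. f s) = (\<integral>s. indicat_real {0<..<1} (1 + (-1) * s) *\<^sub>R f (1 + (-1) * s) \<partial>lborel)"
    unfolding set_lebesgue_integral_def by (subst lborel_integral_real_affine[of "-1" _ 1]) auto
  also have "\<dots> = (LBINT s:{0<..<1}. f (1 - s))"
    unfolding set_lebesgue_integral_def by (intro Bochner_Integration.integral_cong) (auto simp: indicator_def)
  finally show ?thesis .
qed

text \<open>
  In the base region this is the reflection \<open>s \<mapsto> 1 - s\<close> in Euler's integral. Multiplication by
  \<open>t powr a\<close> and the exchange of \<open>b\<close> with \<open>c - b\<close> turn the first contiguous relation into the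
  third and the second into itself, because \<open>t * (1 - 1/t) = - (1 - t)\<close>.
\<close>

theorem hyp2F1_pfaff:
  assumes "Re c > 0" "t \<in> {0<..<1}"
  shows "hyp2F1 a b c (complex_of_real (1 - 1 / t)) =
           complex_of_real t powr a * hyp2F1 a (c - b) c (complex_of_real (1 - t))"
  using assms(1)
proof (induction a b c rule: hypergeo_parameter_induct)
  case (base a b c)
  have slit: "complex_of_real (1 - 1 / t) \<in> slit_plane" "complex_of_real (1 - t) \<in> slit_plane"
    by (rule of_real_in_slit_plane, use assms(2) in simp)+
  have "euler_integral a b (c - b) (complex_of_real (1 - 1 / t)) =
     (LBINT s:{0<..<1}. complex_of_real t powr a * (complex_of_real s powr (c - b - 1) *
      complex_of_real (1 - s) powr (b - 1) * (1 - complex_of_real (1 - t) * complex_of_real s) powr (- a)))"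
    unfolding euler_integral_def
  proof (subst set_integral_reflect_0_1, intro set_lebesgue_integral_cong)
    show "\<forall>s. s \<in> {0<..<1} \<longrightarrow> complex_of_real (1 - s) powr (b - 1) * complex_of_real (1 - (1 - s)) powr (c - b - 1) *
        (1 - complex_of_real (1 - 1 / t) * complex_of_real (1 - s)) powr - a =
        complex_of_real t powr a * (complex_of_real s powr (c - b - 1) * complex_of_real (1 - s) powr (b - 1) *
         (1 - complex_of_real (1 - t) * complex_of_real s) powr - a)"
    proof (intro allI impI)
      fix s :: real assume s: "s \<in> {0<..<1}"
      define q where "q = 1 - (1 - t) * s"
      have "(1 - t) * s < 1 * 1" using s assms(2) by (intro mult_strict_mono) auto
      then have q: "q > 0" by (simp add: q_def)
      have "1 - complex_of_real (1 - 1 / t) * complex_of_real (1 - s) = complex_of_real (1 - (1 - 1 / t) * (1 - s))"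
        by simp
      also have "1 - (1 - 1 / t) * (1 - s) = q / t"
        using assms(2) by (simp add: q_def field_simps)
      finally have 1: "1 - complex_of_real (1 - 1 / t) * complex_of_real (1 - s) = complex_of_real (q / t)" .
      have 3: "complex_of_real (q / t) powr - a = complex_of_real t powr a * complex_of_real q powr (- a)"
        using q assms(2)
        by (simp add: powr_def Ln_of_real ln_div exp_add[symmetric] algebra_simps del: of_real_divide)
      have 2: "1 - complex_of_real (1 - t) * complex_of_real s = complex_of_real q"
        by (simp add: q_def)
      show "complex_of_real (1 - s) powr (b - 1) * complex_of_real (1 - (1 - s)) powr (c - b - 1) *
        (1 - complex_of_real (1 - 1 / t) * complex_of_real (1 - s)) powr - a =
        complex_of_real t powr a * (complex_of_real s powr (c - b - 1) * complex_of_real (1 - s) powr (b - 1) *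
         (1 - complex_of_real (1 - t) * complex_of_real s) powr - a)"
        unfolding 1 2 3 by simp
    qed
  qed simp
  also have "\<dots> = complex_of_real t powr a * euler_integral a (c - b) (c - (c - b)) (complex_of_real (1 - t))"
    unfolding euler_integral_def set_integral_mult_right by simp
  finally have "euler_integral a b (c - b) (complex_of_real (1 - 1 / t)) =
      complex_of_real t powr a * euler_integral a (c - b) (c - (c - b)) (complex_of_real (1 - t))" .
  moreover have "hyp2F1 a b c (complex_of_real (1 - 1 / t)) =
      euler_integral a b (c - b) (complex_of_real (1 - 1 / t)) / (Gamma b * Gamma (c - b) * rGamma c)"
    using base slit by (intro hyp2F1_euler) auto
  moreover have "hyp2F1 a (c - b) c (complex_of_real (1 - t)) =
      euler_integral a (c - b) (c - (c - b)) (complex_of_real (1 - t)) / (Gamma (c - b) * Gamma (c - (c - b)) * rGamma c)"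
    using base slit by (intro hyp2F1_euler) auto
  ultimately show ?case by (simp add: mult_ac)
next
  case (c_shift a b c)
  let ?v = "complex_of_real (1 - 1 / t)" and ?w = "complex_of_real (1 - t)"
  have slit: "?v \<in> slit_plane" "?w \<in> slit_plane"
    by (rule of_real_in_slit_plane, use assms(2) in simp)+
  have t: "complex_of_real t powr (a + 1) = complex_of_real t powr a * complex_of_real t" "complex_of_real t * ?v = - ?w"
    using assms(2) by (auto simp: powr_add field_simps)
  have "hyp2F1 a b c ?v = hyp2F1 a b (c + 1) ?v + a * b / (c * (c + 1)) * ?v * hyp2F1 (a + 1) (b + 1) (c + 2) ?v"
    by (rule hyp2F1_contiguous(1)[OF c_shift(1) slit(1)])
  also have "\<dots> = complex_of_real t powr a * (hyp2F1 a (c - b + 1) (c + 1) ?w +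
       a * b / (c * (c + 1)) * (complex_of_real t * ?v) * hyp2F1 (a + 1) (c - b + 1) (c + 2) ?w)"
    unfolding c_shift.IH t by (simp add: algebra_simps)
  also have "\<dots> = complex_of_real t powr a * hyp2F1 a (c - b) c ?w"
    unfolding t hyp2F1_contiguous(3)[OF c_shift(1) slit(2), of a "c - b"] by (simp del: of_real_diff)
  finally show ?case .
next
  case (b_shift a b c)
  let ?v = "complex_of_real (1 - 1 / t)" and ?w = "complex_of_real (1 - t)"
  have slit: "?v \<in> slit_plane" "?w \<in> slit_plane"
    by (rule of_real_in_slit_plane, use assms(2) in simp)+
  have t: "complex_of_real t powr (a + 1) = complex_of_real t powr a * complex_of_real t" "complex_of_real t * ?v = - ?w"
    using assms(2) by (auto simp: powr_add field_simps)
  have "hyp2F1 a b c ?v = hyp2F1 a (b + 1) c ?v + (- (a / c)) * ?v * hyp2F1 (a + 1) (b + 1) (c + 1) ?v"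
    by (rule hyp2F1_contiguous(2)[OF b_shift(1) slit(1)])
  also have "\<dots> = complex_of_real t powr a * (hyp2F1 a (c - b - 1) c ?w +
       (- (a / c)) * (complex_of_real t * ?v) * hyp2F1 (a + 1) (c - b) (c + 1) ?w)"
    unfolding b_shift.IH t by (simp add: algebra_simps)
  also have "\<dots> = complex_of_real t powr a * hyp2F1 a (c - b) c ?w"
    unfolding t hyp2F1_contiguous(2)[OF b_shift(1) slit(2), of a "c - b - 1"] by (simp del: of_real_diff)
  finally show ?case .
qed

section \<open>Growth on the negative axis, uniformly in the lower parameter\<close>

lemma Gamma_upper:
  assumes "Re z > 0"
  obtains C where "C > 0"
    "\<And>n. cmod (Gamma (z + of_nat n)) \<le> C * (fact n * (real n + 1) powr (Re z - 1))"
proof -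
  have z: "z \<notin> \<int>\<^sub>\<le>\<^sub>0" using assms by (rule not_nonpos_Int_if_Re_pos)
  have G: "Gamma z \<noteq> 0" using z by (simp add: Gamma_eq_zero_iff)
  from pochhammer_upper[of z] obtain C where C: "C > 0"
    "\<And>n. cmod (pochhammer z n) \<le> C * (fact n * (real n + 1) powr (Re z - 1))" by blast
  have "cmod (Gamma (z + of_nat n)) \<le> (cmod (Gamma z) * C) * (fact n * (real n + 1) powr (Re z - 1))" for n
  proof -
    have "Gamma (z + of_nat n) = Gamma z * pochhammer z n"
      using pochhammer_Gamma[OF z, of n] G by simp
    then show ?thesis
      using mult_left_mono[OF C(2)[of n], of "cmod (Gamma z)"] by (simp add: norm_mult mult_ac)
  qed
  with C(1) G show ?thesis by (intro that[of "cmod (Gamma z) * C"]) auto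
qed

lemma Gamma_quotient_upper:
  assumes "Re z > 0"
  obtains C where "C > 0"
    "\<And>n. cmod (Gamma (z + of_nat n) * rGamma (w + of_nat n)) \<le> C * (real n + 1) powr (Re z - Re w)"
proof -
  from Gamma_upper[OF assms] obtain A where A: "A > 0"
    "\<And>n. cmod (Gamma (z + of_nat n)) \<le> A * (fact n * (real n + 1) powr (Re z - 1))" by blast
  from rGamma_upper[of w] obtain B where B: "B > 0"
    "\<And>n. cmod (rGamma (w + of_nat n)) \<le> B * ((real n + 1) powr (1 - Re w) / fact n)" by blast
  have "cmod (Gamma (z + of_nat n) * rGamma (w + of_nat n)) \<le> (A * B) * (real n + 1) powr (Re z - Re w)" for n
  proof -
    have "cmod (Gamma (z + of_nat n) * rGamma (w + of_nat n)) \<le>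
            (A * (fact n * (real n + 1) powr (Re z - 1))) * (B * ((real n + 1) powr (1 - Re w) / fact n))"
      unfolding norm_mult using A B by (intro mult_mono) auto
    also have "\<dots> = (A * B) * ((real n + 1) powr (Re z - 1) * (real n + 1) powr (1 - Re w))"
      by simp
    also have "(real n + 1) powr (Re z - 1) * (real n + 1) powr (1 - Re w) = (real n + 1) powr (Re z - Re w)"
      by (subst powr_add[symmetric]) simp
    finally show ?thesis .
  qed
  with A(1) B(1) show ?thesis by (intro that[of "A * B"]) auto
qed

lemma Beta_upper:
  fixes x y :: real
  assumes "x > 0" "y > 0"
  obtains C where "C > 0" "\<And>n. Beta x (y + real n) \<le> C * (real n + 1) powr (- x)"
proof -
  from Gamma_quotient_upper[of "complex_of_real y" "complex_of_real (x + y)"] obtain C where C: "C > 0"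
    "\<And>n. cmod (Gamma (complex_of_real y + of_nat n) * rGamma (complex_of_real (x + y) + of_nat n)) \<le>
       C * (real n + 1) powr (Re (complex_of_real y) - Re (complex_of_real (x + y)))"
    using assms(2) by auto
  have "Beta x (y + real n) \<le> (Gamma x * C) * (real n + 1) powr (- x)" for n
  proof -
    have "complex_of_real (Beta x (y + real n)) = complex_of_real (Gamma x) *
        (Gamma (complex_of_real y + of_nat n) * rGamma (complex_of_real (x + y) + of_nat n))"
      unfolding Beta_complex_of_real[symmetric] by (simp add: Beta_altdef Gamma_complex_of_real add_ac)
    then have "cmod (complex_of_real (Beta x (y + real n))) = Gamma x *
        cmod (Gamma (complex_of_real y + of_nat n) * rGamma (complex_of_real (x + y) + of_nat n))"
      using Gamma_real_pos[OF assms(1)] by (simp only: norm_mult) simp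
    then have "\<bar>Beta x (y + real n)\<bar> \<le> Gamma x * (C * (real n + 1) powr (- x))"
      using mult_left_mono[OF C(2)[of n], of "Gamma x"] Gamma_real_pos[OF assms(1)] by simp
    then show ?thesis by (simp add: mult.assoc)
  qed
  with C(1) Gamma_real_pos[OF assms(1)] show ?thesis by (intro that[of "Gamma x * C"]) auto
qed

text \<open>
  The functions \<open>1 + y * s\<close> and \<open>1 + y / M\<close> agree for \<open>s = 1 / M\<close>, and their quotient lies
  between \<open>1\<close> and \<open>s * M\<close>.
\<close>

lemma powr_compare_scaled:
  fixes M s y K :: real
  assumes "M > 0" "s > 0" "y \<ge> 0"
  shows "(1 + y * s) powr K \<le> (1 + y / M) powr K * (1 + (s * M) powr K)"
proof (cases "K \<ge> 0")
  case True
  have "1 + y * s \<le> max 1 (s * M) * (1 + y / M)"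
  proof -
    have "y * s = (s * M) * (y / M)" using assms by simp
    also have "\<dots> \<le> max 1 (s * M) * (y / M)" using assms by (intro mult_right_mono) auto
    finally show ?thesis by (simp add: algebra_simps)
  qed
  then have "(1 + y * s) powr K \<le> (max 1 (s * M) * (1 + y / M)) powr K"
    using assms True by (intro powr_mono2) auto
  also have "\<dots> = max 1 (s * M) powr K * (1 + y / M) powr K"
    using assms by (subst powr_mult) auto
  also have "max 1 (s * M) powr K \<le> 1 + (s * M) powr K" by (auto simp: max_def)
  finally show ?thesis using assms by (simp add: mult_right_mono mult.commute)
next
  case False
  have "min 1 (s * M) * (1 + y / M) \<le> 1 + y * s"
  proof -
    have "min 1 (s * M) * (y / M) \<le> (s * M) * (y / M)" using assms by (intro mult_right_mono) auto
    also have "\<dots> = y * s" using assms by simp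
    finally show ?thesis by (simp add: algebra_simps)
  qed
  then have "(1 + y * s) powr K \<le> (min 1 (s * M) * (1 + y / M)) powr K"
    using assms False by (intro powr_mono2') (auto intro!: mult_pos_pos add_pos_nonneg)
  also have "\<dots> = min 1 (s * M) powr K * (1 + y / M) powr K"
    using assms by (subst powr_mult) auto
  also have "min 1 (s * M) powr K \<le> 1 + (s * M) powr K" by (auto simp: min_def)
  finally show ?thesis using assms by (simp add: mult_right_mono mult.commute)
qed

lemma neg_real_in_slit_plane: "y \<ge> 0 \<Longrightarrow> - complex_of_real y \<in> slit_plane"
  using of_real_in_slit_plane[of "- y"] by simp

text \<open>
  In Euler's integral the mass of \<open>(1 - s) powr (d - 1)\<close> for large \<open>d\<close> sits at \<open>s\<close> of order
  \<open>1 / d\<close>; \<open>M\<close> is meant to be of that order of \<open>d\<close>.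
\<close>

lemma euler_integral_upper:
  assumes "Re b > 0" "Re d > 0" "y \<ge> 0" "M > 0" "K \<ge> - Re a" "K > - Re b"
  shows "cmod (euler_integral a b d (- complex_of_real y)) \<le>
           (1 + y / M) powr K * (Beta (Re b) (Re d) + M powr K * Beta (Re b + K) (Re d))"
proof -
  define f where "f s = complex_of_real s powr (b - 1) * complex_of_real (1 - s) powr (d - 1) *
            (1 - (- complex_of_real y) * complex_of_real s) powr (- a)" for s
  define g where "g s = (1 + y / M) powr K * (s powr (Re b - 1) * (1 - s) powr (Re d - 1) +
       M powr K * (s powr (Re b + K - 1) * (1 - s) powr (Re d - 1)))" for s
  have bK: "Re b + K > 0" using assms by simp
  note i1 = beta_integral_real[OF assms(1,2)] and i2 = beta_integral_real[OF bK assms(2)]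
  have gi: "set_integrable lborel {0<..<1} g"
    unfolding g_def by (intro set_integrable_mult_right set_integral_add i1 i2)
  have gv: "(LBINT s:{0<..<1}. g s) = (1 + y / M) powr K * (Beta (Re b) (Re d) + M powr K * Beta (Re b + K) (Re d))"
    unfolding g_def
    by (simp only: set_integral_mult_right set_integral_add(2)[OF i1(1) set_integrable_mult_right[OF i2(1)]] i1(2) i2(2))
  have fg: "cmod (f s) \<le> g s" if s: "s \<in> {0<..<1}" for s
  proof -
    have pos: "1 + y * s > 0" using s assms by (intro add_pos_nonneg) auto
    have "1 - (- complex_of_real y) * complex_of_real s = complex_of_real (1 + y * s)" by simp
    then have "cmod (f s) = (s powr (Re b - 1) * (1 - s) powr (Re d - 1)) * (1 + y * s) powr (- Re a)"
      unfolding f_def norm_mult[of "_ * _"] beta_kernel_cmod[OF s]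
      using pos by (simp add: cmod_of_real_powr del: of_real_add of_real_mult)
    also have "\<dots> \<le> (s powr (Re b - 1) * (1 - s) powr (Re d - 1)) * ((1 + y / M) powr K * (1 + (s * M) powr K))"
    proof (intro mult_left_mono)
      have "(1 + y * s) powr (- Re a) \<le> (1 + y * s) powr K"
        using s assms by (intro powr_mono) auto
      also have "\<dots> \<le> (1 + y / M) powr K * (1 + (s * M) powr K)"
        using s assms by (intro powr_compare_scaled) auto
      finally show "(1 + y * s) powr (- Re a) \<le> (1 + y / M) powr K * (1 + (s * M) powr K)" .
    qed auto
    also have "\<dots> = g s"
    proof -
      have "s powr (Re b + K - 1) = s powr (Re b - 1) * s powr K"
        by (subst powr_add[symmetric]) (simp add: algebra_simps)
      moreover have "(s * M) powr K = s powr K * M powr K" using s assms by (simp add: powr_mult)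
      ultimately show ?thesis by (simp add: g_def algebra_simps)
    qed
    finally show ?thesis .
  qed
  have fc: "continuous_on {0<..<1} f"
    unfolding f_def
    using one_minus_mult_notin_nonpos_Reals[OF neg_real_in_slit_plane[OF assms(3)]]
    by (intro continuous_on_mult continuous_on_beta_kernel continuous_on_powr_slit continuous_intros) auto
  have "cmod (euler_integral a b d (- complex_of_real y)) \<le> (LBINT s:{0<..<1}. cmod (f s))"
    unfolding euler_integral_def f_def[symmetric] set_lebesgue_integral_def
    using integral_norm_bound[of lborel "\<lambda>s. indicat_real {0<..<1} s *\<^sub>R f s"] by simp
  also have "\<dots> \<le> (LBINT s:{0<..<1}. g s)"
    by (rule set_integrable_norm_bound(2)[OF gi fc _ fg]) auto
  finally show ?thesis unfolding gv .
qed

text \<open>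
  In the base region the Beta values of \<open>euler_integral_upper\<close> with \<open>M = m + 1\<close> and the constant in front of
  Euler's integral balance exactly. In the contiguous relations the coefficient of the second term
  contributes a factor \<open>y / (m + 1)\<close>, while raising both \<open>a\<close> and \<open>b\<close> allows the exponent
  \<open>K - 1\<close> there; so the exponent \<open>K\<close> is preserved. It is essential for this that \<open>K\<close> may be negative.
\<close>

theorem hyp2F1_uniform_upper:
  assumes "Re c > 0"
  shows "\<forall>K. - Re a < K \<and> - Re b < K \<longrightarrow> (\<exists>C\<ge>0. \<forall>m. \<forall>y\<ge>0.
           cmod (hyp2F1 a b (c + of_nat m) (- complex_of_real y)) \<le> C * (1 + y / (real m + 1)) powr K)"
proof -
  have combine: "cmod F \<le> (C1 + D * C2) * Y powr K"
    if "F = F1 + k * F2" "cmod F1 \<le> C1 * Y powr K" "cmod k \<le> D * Y" "cmod F2 \<le> C2 * Y powr (K - 1)"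
       "Y > 0" for F F1 k F2 :: complex and C1 C2 D Y K :: real
  proof -
    have "cmod F \<le> cmod F1 + cmod k * cmod F2"
      unfolding that(1) using norm_triangle_ineq[of F1 "k * F2"] by (simp add: norm_mult)
    also have "\<dots> \<le> C1 * Y powr K + (D * Y) * (C2 * Y powr (K - 1))"
      using that by (intro add_mono mult_mono) (auto intro: order.trans[OF norm_ge_zero])
    also have "Y * Y powr (K - 1) = Y powr K" using that(5) by (simp add: powr_diff)
    then have "C1 * Y powr K + (D * Y) * (C2 * Y powr (K - 1)) = (C1 + D * C2) * Y powr K"
      by (simp add: algebra_simps)
    finally show ?thesis .
  qed
  have den: "min (Re c) 1 * (real m + 1) \<le> cmod (c + of_nat m)" if "Re c > 0" for c m
  proof -
    have "min (Re c) 1 * real m \<le> 1 * real m" by (intro mult_right_mono) auto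
    then have "min (Re c) 1 * (real m + 1) \<le> Re (c + of_nat m)" by (simp add: algebra_simps)
    also have "\<dots> \<le> cmod (c + of_nat m)" by (rule complex_Re_le_cmod)
    finally show ?thesis .
  qed
  have quot: "cmod (u / (c + of_nat m) * (- complex_of_real y)) \<le> cmod u / min (Re c) 1 * (1 + y / (real m + 1))"
    if "Re c > 0" "y \<ge> 0" for u c m y
  proof -
    have "cmod (u / (c + of_nat m) * (- complex_of_real y)) = cmod u * y / cmod (c + of_nat m)"
      using that by (simp add: norm_mult norm_divide)
    also have "\<dots> \<le> cmod u * y / (min (Re c) 1 * (real m + 1))"
    proof (intro divide_left_mono den mult_pos_pos)
      show "0 < cmod (c + of_nat m)"
        using that by (intro order.strict_trans2[OF _ den]) auto
    qed (use that in auto)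
    also have "\<dots> = cmod u / min (Re c) 1 * (y / (real m + 1))" by simp
    also have "\<dots> \<le> cmod u / min (Re c) 1 * (1 + y / (real m + 1))"
      using that by (intro mult_left_mono) auto
    finally show ?thesis .
  qed
  show ?thesis using assms
  proof (induction a b c rule: hypergeo_parameter_induct)
    case (base a b c)
    show ?case
    proof (intro allI impI)
      fix K assume K: "- Re a < K \<and> - Re b < K"
      define d where "d = c - b"
      have pos: "Re b > 0" "Re d > 0" "Re c > 0" "Re b + K > 0" using base K by (auto simp: d_def)
      from Beta_upper[OF pos(1,2)] obtain C1 where C1: "C1 > 0"
        "\<And>n. Beta (Re b) (Re d + real n) \<le> C1 * (real n + 1) powr (- Re b)" by blast
      from Beta_upper[OF pos(4,2)] obtain C2 where C2: "C2 > 0"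
        "\<And>n. Beta (Re b + K) (Re d + real n) \<le> C2 * (real n + 1) powr (- (Re b + K))" by blast
      from Gamma_quotient_upper[OF pos(3), of d] obtain C3 where C3: "C3 > 0"
        "\<And>n. cmod (Gamma (c + of_nat n) * rGamma (d + of_nat n)) \<le> C3 * (real n + 1) powr (Re c - Re d)" by blast
      define C where "C = (C1 + C2) * C3 / cmod (Gamma b)"
      have "cmod (hyp2F1 a b (c + of_nat m) (- complex_of_real y)) \<le> C * (1 + y / (real m + 1)) powr K" if y: "y \<ge> 0" for m y
      proof -
        let ?Y = "(1 + y / (real m + 1)) powr K" and ?N = "real m + 1"
        have "hyp2F1 a b (c + of_nat m) (- complex_of_real y) =
           euler_integral a b (c + of_nat m - b) (- complex_of_real y) / (Gamma b * Gamma (c + of_nat m - b) * rGamma (c + of_nat m))"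
          using base neg_real_in_slit_plane[OF y] by (intro hyp2F1_euler) auto
        also have "c + of_nat m - b = d + of_nat m" by (simp add: d_def)
        finally have eq: "hyp2F1 a b (c + of_nat m) (- complex_of_real y) =
           euler_integral a b (d + of_nat m) (- complex_of_real y) / (Gamma b * Gamma (d + of_nat m) * rGamma (c + of_nat m))" .
        have "cmod (hyp2F1 a b (c + of_nat m) (- complex_of_real y)) =
           cmod (euler_integral a b (d + of_nat m) (- complex_of_real y)) *
             (cmod (Gamma (c + of_nat m) * rGamma (d + of_nat m)) / cmod (Gamma b))"
          unfolding eq by (simp add: norm_mult norm_divide rGamma_inverse_Gamma norm_inverse divide_simps)
        also have "\<dots> \<le> (?Y * ((C1 + C2) * ?N powr (- Re b))) * (C3 * ?N powr (Re c - Re d) / cmod (Gamma b))"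
        proof (intro mult_mono divide_right_mono C3(2))
          have "cmod (euler_integral a b (d + of_nat m) (- complex_of_real y)) \<le>
             ?Y * (Beta (Re b) (Re (d + of_nat m)) + ?N powr K * Beta (Re b + K) (Re (d + of_nat m)))"
            using pos y K by (intro euler_integral_upper) auto
          also have "\<dots> \<le> ?Y * (C1 * ?N powr (- Re b) + ?N powr K * (C2 * ?N powr (- (Re b + K))))"
            using C1(2)[of m] C2(2)[of m] by (intro mult_left_mono add_mono) auto
          also have "?N powr K * (C2 * ?N powr (- (Re b + K))) = C2 * (?N powr K * ?N powr (- (Re b + K)))"
            by (simp only: mult_ac)
          also have "?N powr K * ?N powr (- (Re b + K)) = ?N powr (- Re b)"
            by (subst powr_add[symmetric]) simp
          finally show "cmod (euler_integral a b (d + of_nat m) (- complex_of_real y)) \<le> ?Y * ((C1 + C2) * ?N powr (- Re b))"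
            by (simp add: algebra_simps)
        qed (use C1 C2 in auto)
        also have "\<dots> = C * ?Y * (?N powr (- Re b) * ?N powr (Re c - Re d))"
          by (simp add: C_def)
        also have "?N powr (- Re b) * ?N powr (Re c - Re d) = 1"
          by (subst powr_add[symmetric]) (simp add: d_def)
        finally show ?thesis by simp
      qed
      moreover have "C \<ge> 0" using C1 C2 C3 by (simp add: C_def)
      ultimately show "\<exists>C\<ge>0. \<forall>m. \<forall>y\<ge>0.
           cmod (hyp2F1 a b (c + of_nat m) (- complex_of_real y)) \<le> C * (1 + y / (real m + 1)) powr K"
        by blast
    qed
  next
    case (c_shift a b c)
    show ?case
    proof (intro allI impI)
      fix K assume K: "- Re a < K \<and> - Re b < K"
      from c_shift.IH(1)[rule_format, OF K] obtain C1 where C1: "C1 \<ge> 0" "\<And>m y. y \<ge> 0 \<Longrightarrow>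
           cmod (hyp2F1 a b (c + 1 + of_nat m) (- complex_of_real y)) \<le> C1 * (1 + y / (real m + 1)) powr K" by blast
      from c_shift.IH(2)[rule_format, of "K - 1"] K obtain C2 where C2: "C2 \<ge> 0" "\<And>m y. y \<ge> 0 \<Longrightarrow>
           cmod (hyp2F1 (a + 1) (b + 1) (c + 2 + of_nat m) (- complex_of_real y)) \<le> C2 * (1 + y / (real m + 1)) powr (K - 1)"
        by auto
      define D where "D = cmod (a * b) / min (Re c) 1"
      have "cmod (hyp2F1 a b (c + of_nat m) (- complex_of_real y)) \<le> (C1 + D * C2) * (1 + y / (real m + 1)) powr K" if y: "y \<ge> 0" for m y
      proof (rule combine[OF _ C1(2)[OF y] _ C2(2)[OF y]])
        show "hyp2F1 a b (c + of_nat m) (- complex_of_real y) = hyp2F1 a b (c + 1 + of_nat m) (- complex_of_real y) +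
           (a * b / ((c + of_nat m) * (c + of_nat m + 1)) * (- complex_of_real y)) * hyp2F1 (a + 1) (b + 1) (c + 2 + of_nat m) (- complex_of_real y)"
          using hyp2F1_contiguous(1)[OF _ neg_real_in_slit_plane[OF y], of "c + of_nat m" a b] c_shift(1)
          by (simp add: add.assoc add.commute[of "of_nat m"])
        have "1 \<le> Re (c + of_nat m + 1)" using c_shift(1) by simp
        also have "\<dots> \<le> cmod (c + of_nat m + 1)" by (rule complex_Re_le_cmod)
        finally have ge1: "1 \<le> cmod (c + of_nat m + 1)" .
        have "cmod (a * b / ((c + of_nat m) * (c + of_nat m + 1)) * (- complex_of_real y)) =
              cmod (a * b / (c + of_nat m) * (- complex_of_real y)) / cmod (c + of_nat m + 1)"
          by (simp add: norm_mult norm_divide)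
        also have "\<dots> \<le> cmod (a * b / (c + of_nat m) * (- complex_of_real y)) / 1"
          using ge1 by (intro divide_left_mono) auto
        also have "\<dots> \<le> D * (1 + y / (real m + 1))"
          unfolding D_def div_by_1 by (rule quot[OF c_shift(1) y])
        finally show "cmod (a * b / ((c + of_nat m) * (c + of_nat m + 1)) * (- complex_of_real y)) \<le> D * (1 + y / (real m + 1))" .
        show "1 + y / (real m + 1) > 0" using y by (intro add_pos_nonneg) auto
      qed
      moreover have "C1 + D * C2 \<ge> 0" using C1 C2 c_shift(1) by (simp add: D_def)
      ultimately show "\<exists>C\<ge>0. \<forall>m. \<forall>y\<ge>0.
           cmod (hyp2F1 a b (c + of_nat m) (- complex_of_real y)) \<le> C * (1 + y / (real m + 1)) powr K"
        by blast
    qed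
  next
    case (b_shift a b c)
    show ?case
    proof (intro allI impI)
      fix K assume K: "- Re a < K \<and> - Re b < K"
      from b_shift.IH(1)[rule_format, of K] K obtain C1 where C1: "C1 \<ge> 0" "\<And>m y. y \<ge> 0 \<Longrightarrow>
           cmod (hyp2F1 a (b + 1) (c + of_nat m) (- complex_of_real y)) \<le> C1 * (1 + y / (real m + 1)) powr K" by auto
      from b_shift.IH(2)[rule_format, of "K - 1"] K obtain C2 where C2: "C2 \<ge> 0" "\<And>m y. y \<ge> 0 \<Longrightarrow>
           cmod (hyp2F1 (a + 1) (b + 1) (c + 1 + of_nat m) (- complex_of_real y)) \<le> C2 * (1 + y / (real m + 1)) powr (K - 1)"
        by auto
      define D where "D = cmod (- a) / min (Re c) 1"
      have "cmod (hyp2F1 a b (c + of_nat m) (- complex_of_real y)) \<le> (C1 + D * C2) * (1 + y / (real m + 1)) powr K" if y: "y \<ge> 0" for m y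
      proof (rule combine[OF _ C1(2)[OF y] _ C2(2)[OF y]])
        show "hyp2F1 a b (c + of_nat m) (- complex_of_real y) = hyp2F1 a (b + 1) (c + of_nat m) (- complex_of_real y) +
           (- a / (c + of_nat m) * (- complex_of_real y)) * hyp2F1 (a + 1) (b + 1) (c + 1 + of_nat m) (- complex_of_real y)"
          using hyp2F1_contiguous(2)[OF _ neg_real_in_slit_plane[OF y], of "c + of_nat m" a b] b_shift(1)
          by (simp add: add.assoc add.commute[of "of_nat m"])
        show "cmod (- a / (c + of_nat m) * (- complex_of_real y)) \<le> D * (1 + y / (real m + 1))"
          unfolding D_def by (rule quot[OF b_shift(1) y])
        show "1 + y / (real m + 1) > 0" using y by (intro add_pos_nonneg) auto
      qed
      moreover have "C1 + D * C2 \<ge> 0" using C1 C2 b_shift(1) by (simp add: D_def)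
      ultimately show "\<exists>C\<ge>0. \<forall>m. \<forall>y\<ge>0.
           cmod (hyp2F1 a b (c + of_nat m) (- complex_of_real y)) \<le> C * (1 + y / (real m + 1)) powr K"
        by blast
    qed
  qed
qed

section \<open>A Beta transform of the Gauss function\<close>

text \<open>
  In the variable \<open>y = 1/t - 1\<close> the integral of this function over the unit interval is that of
  \<open>y powr (c - 1) * (1 + y) powr (- c - r) * 2F1(a, b; c; - y)\<close> over the half-line.
\<close>

definition mellin_kernel :: "complex \<Rightarrow> complex \<Rightarrow> complex \<Rightarrow> complex \<Rightarrow> real \<Rightarrow> complex" where
  "mellin_kernel a b c r t = complex_of_real t powr (r - 1) * complex_of_real (1 - t) powr (c - 1) *
     hyp2F1 a b c (complex_of_real (1 - 1 / t))"

text \<open>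
  Pfaff's transformation and termwise Beta integrals lead to a Gauss series at \<open>1\<close> with parameters
  \<open>a\<close>, \<open>c - b\<close> and \<open>c + r + a\<close>. The integrals of the absolute values are at most of order
  \<open>n powr (- Re (r + b) - 1)\<close>.
\<close>

theorem hyp2F1_beta_transform:
  assumes c: "Re c > 0" and ra: "Re (r + a) > 0" and rb: "Re (r + b) > 0"
  shows "(LBINT t:{0<..<1}. mellin_kernel a b c r t) =
           Gamma c * Gamma (r + a) * Gamma (r + b) * rGamma (c + r) * rGamma (r + a + b)"
proof -
  define h where "h = gauss_coeff a (c - b) c"
  define f where "f n t = h n * (complex_of_real t powr (r + a - 1) * complex_of_real (1 - t) powr (c + of_nat n - 1))" for n t
  have cn: "Re (c + of_nat n) > 0" for n using c by (simp add: add_pos_nonneg)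
  have cp: "c \<notin> \<int>\<^sub>\<le>\<^sub>0" using c by (rule not_nonpos_Int_if_Re_pos)
  have f: "f n t = (complex_of_real t powr (r + a - 1) * complex_of_real (1 - t) powr (c - 1)) * (h n * complex_of_real (1 - t) ^ n)"
    if t: "t \<in> {0<..<1}" for n t
  proof -
    have "complex_of_real (1 - t) \<noteq> 0" using t by (simp del: of_real_diff)
    then have "complex_of_real (1 - t) powr (c + of_nat n - 1) = complex_of_real (1 - t) powr (c - 1) * complex_of_real (1 - t) ^ n"
      using powr_add[of "complex_of_real (1 - t)" "c - 1" "of_nat n"] by (simp add: algebra_simps del: of_real_diff)
    then show ?thesis by (simp add: f_def del: of_real_diff)
  qed
  have sm: "summable (\<lambda>n. cmod (h n * complex_of_real (1 - t) ^ n))" if t: "t \<in> {0<..<1}" for t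
    unfolding h_def using t cp by (intro summable_gauss_coeff) (auto simp del: of_real_diff)
  have fsum: "(\<Sum>n. f n t) = mellin_kernel a b c r t" if t: "t \<in> {0<..<1}" for t
  proof -
    have "(\<Sum>n. f n t) = (complex_of_real t powr (r + a - 1) * complex_of_real (1 - t) powr (c - 1)) *
            (\<Sum>n. h n * complex_of_real (1 - t) ^ n)"
      unfolding f[OF t] by (rule suminf_mult[OF summable_norm_cancel[OF sm[OF t]]])
    also have "(\<Sum>n. h n * complex_of_real (1 - t) ^ n) = hyp2F1 a (c - b) c (complex_of_real (1 - t))"
      using t by (subst hyp2F1_eq_hypergeo[OF c]) (auto simp: hypergeo_2F1 h_def simp del: of_real_diff)
    also have "complex_of_real t powr (r + a - 1) = complex_of_real t powr (r - 1) * complex_of_real t powr a"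
      by (subst powr_add[symmetric]) (simp add: algebra_simps)
    finally show ?thesis unfolding mellin_kernel_def hyp2F1_pfaff[OF c t] by (simp only: mult_ac)
  qed
  from gauss_coeff_upper[OF cp] obtain A where A: "A > 0"
    "\<And>n. cmod (h n) \<le> A * (real n + 1) powr (Re (a + (c - b) - c) - 1)" unfolding h_def by blast
  from Beta_upper[OF ra c] obtain B where B: "B > 0"
    "\<And>n. Beta (Re (r + a)) (Re c + real n) \<le> B * (real n + 1) powr (- Re (r + a))" by blast
  have "(\<lambda>n. LBINT t:{0<..<1}. f n t) sums (LBINT t:{0<..<1}. \<Sum>n. f n t)"
  proof (rule set_integral_suminf(2))
    show "set_integrable lborel {0<..<1} (f n)" for n
      unfolding f_def by (intro set_integrable_mult_right integrable_beta_kernel(1) ra cn)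
    show "summable (\<lambda>n. cmod (f n t))" if "t \<in> {0<..<1}" for t
      unfolding f[OF that] norm_mult[of "_ * _" "_ * _"] by (intro summable_mult sm that)
    show "(LBINT t:{0<..<1}. cmod (f n t)) \<le> (A * B) * (real n + 1) powr (- Re (r + b) - 1)" for n
    proof -
      have "(LBINT t:{0<..<1}. cmod (f n t)) = cmod (h n) * Beta (Re (r + a)) (Re c + real n)"
        unfolding f_def norm_mult[of "h n"] set_integral_mult_right integrable_beta_kernel(2)[OF ra cn] by simp
      also have "\<dots> \<le> (A * (real n + 1) powr (Re (a + (c - b) - c) - 1)) * (B * (real n + 1) powr (- Re (r + a)))"
      proof (intro mult_mono A B)
        have "Re c + real n > 0" using c by (simp add: add_pos_nonneg)
        then show "0 \<le> Beta (Re (r + a)) (Re c + real n)"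
          using Gamma_real_pos[OF ra] Gamma_real_pos[of "Re c + real n"] Gamma_real_pos[of "Re (r + a) + (Re c + real n)"] ra
          unfolding Beta_def by (intro divide_nonneg_nonneg mult_nonneg_nonneg) auto
      qed (use A in auto)
      also have "\<dots> = (A * B) * ((real n + 1) powr (Re (a + (c - b) - c) - 1) * (real n + 1) powr (- Re (r + a)))"
        by simp
      also have "(real n + 1) powr (Re (a + (c - b) - c) - 1) * (real n + 1) powr (- Re (r + a)) = (real n + 1) powr (- Re (r + b) - 1)"
        by (subst powr_add[symmetric], rule arg_cong[where f = "\<lambda>u. (real n + 1) powr u"]) simp
      finally show ?thesis .
    qed
    show "summable (\<lambda>n. (A * B) * (real n + 1) powr (- Re (r + b) - 1))"
      using rb by (intro summable_mult summable_Suc_powr) auto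
  qed
  also have "(LBINT t:{0<..<1}. \<Sum>n. f n t) = (LBINT t:{0<..<1}. mellin_kernel a b c r t)"
    by (intro set_lebesgue_integral_cong) (auto simp: fsum)
  finally have 1: "(\<lambda>n. LBINT t:{0<..<1}. f n t) sums (LBINT t:{0<..<1}. mellin_kernel a b c r t)" .
  have 2: "(LBINT t:{0<..<1}. f n t) = Gamma (r + a) * Gamma c *
      (pochhammer a n * pochhammer (c - b) n * rGamma (c + r + a + of_nat n) / fact n)" for n
  proof -
    have "(LBINT t:{0<..<1}. f n t) = h n * (Gamma (r + a) * Gamma (c + of_nat n) * rGamma (r + a + (c + of_nat n)))"
      unfolding f_def set_integral_mult_right beta_integral_complex[OF ra cn] ..
    moreover have "Gamma (c + of_nat n) = pochhammer c n * Gamma c"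
      using pochhammer_Gamma[OF cp, of n] cp by (simp add: Gamma_eq_zero_iff)
    moreover have "pochhammer c n \<noteq> 0" using cp by (auto simp: pochhammer_eq_0_iff)
    moreover have "r + a + (c + of_nat n) = c + r + a + of_nat n" by simp
    ultimately show ?thesis by (simp add: h_def gauss_coeff_def)
  qed
  have "Re (c + r + a - a - (c - b)) > 0" using rb by simp
  from sums_mult[OF gauss_summation[OF this], of "Gamma (r + a) * Gamma c"]
  have "(\<lambda>n. LBINT t:{0<..<1}. f n t) sums
     (Gamma (r + a) * Gamma c * (Gamma (r + b) * rGamma (c + r) * rGamma (r + a + b)))"
    unfolding 2 by (simp add: algebra_simps)
  with 1 have "(LBINT t:{0<..<1}. mellin_kernel a b c r t) =
     Gamma (r + a) * Gamma c * (Gamma (r + b) * rGamma (c + r) * rGamma (r + a + b))"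
    by (rule sums_unique2)
  then show ?thesis by (simp only: mult_ac)
qed

lemma continuous_on_mellin_kernel:
  assumes "Re c > 0"
  shows "continuous_on {0<..<1} (mellin_kernel a b c r)"
  unfolding mellin_kernel_def
proof (rule continuous_on_mult[OF continuous_on_beta_kernel])
  show "continuous_on {0<..<1} (\<lambda>t. hyp2F1 a b c (complex_of_real (1 - 1 / t)))"
  proof (rule continuous_on_compose2[OF holomorphic_on_imp_continuous_on[OF hyp2F1_holomorphic[OF assms]]])
    show "(\<lambda>t. complex_of_real (1 - 1 / t)) ` {0<..<1} \<subseteq> slit_plane"
      using of_real_in_slit_plane by (auto simp del: Compl_iff of_real_diff)
  qed (auto intro!: continuous_intros)
qed

lemma powr_scaled_upper:
  fixes t M K :: real
  assumes t: "t \<in> {0<..<1}" and M: "M \<ge> 1"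
  shows "(1 + (1 / t - 1) / M) powr K \<le>
           2 powr \<bar>K\<bar> * ((t * M) powr (- K) + (t * M) powr (- min K 0))"
proof -
  define q where "q = t * M"
  have q: "q > 0" using t M by (simp add: q_def)
  have eq: "1 + (1 / t - 1) / M = 1 / q + (1 - 1 / M)"
    using t M by (simp add: q_def field_simps)
  have inv: "(1 / q) powr K = q powr (- K)" using q by (simp add: powr_minus powr_divide field_simps)
  show ?thesis
  proof (cases "K \<ge> 0")
    case True
    have "1 + (1 / t - 1) / M \<le> 2 * max 1 (1 / q)"
    proof -
      have "1 / M \<ge> 0" "1 / q \<le> max 1 (1 / q)" "1 \<le> max 1 (1 / q)" using M by auto
      then show ?thesis unfolding eq by linarith
    qed
    moreover have "0 \<le> 1 + (1 / t - 1) / M"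
      unfolding eq using M q by (intro add_nonneg_nonneg) auto
    ultimately have "(1 + (1 / t - 1) / M) powr K \<le> (2 * max 1 (1 / q)) powr K"
      using True by (intro powr_mono2) auto
    also have "\<dots> = 2 powr K * max 1 (1 / q) powr K" by (simp add: powr_mult)
    also have "max 1 (1 / q) powr K \<le> q powr (- K) + 1" by (auto simp: max_def inv)
    finally show ?thesis using True q by (simp add: q_def[symmetric] mult_left_mono)
  next
    case False
    have "1 / q \<le> 1 + (1 / t - 1) / M" unfolding eq using M by simp
    then have "(1 + (1 / t - 1) / M) powr K \<le> (1 / q) powr K"
      using False q by (intro powr_mono2') auto
    also have "\<dots> \<le> 2 powr \<bar>K\<bar> * (q powr (- K) + q powr (- min K 0))"
    proof -
      have "1 * q powr (- K) \<le> 2 powr \<bar>K\<bar> * (q powr (- K) + q powr (- min K 0))"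
        by (intro mult_mono) (auto simp: ge_one_powr_ge_zero)
      then show ?thesis unfolding inv by simp
    qed
    finally show ?thesis by (simp add: q_def)
  qed
qed

text \<open>
  A uniform pointwise bound integrates to Beta values that decay like a power of \<open>m\<close>. The exponent \<open>K\<close> can be
  chosen below \<open>Re r\<close>, as integrability at \<open>t = 0\<close> requires, because \<open>r + a\<close> and \<open>r + b\<close> have positive
  real part.
\<close>

theorem mellin_kernel_uniform_integrable:
  assumes c: "Re c > 0" and ra: "Re (r + a) > 0" and rb: "Re (r + b) > 0"
  obtains C where "C > 0"
    "\<And>m. set_integrable lborel {0<..<1} (mellin_kernel a b (c + of_nat m) r)"
    "\<And>m. (LBINT t:{0<..<1}. cmod (mellin_kernel a b (c + of_nat m) r t)) \<le> C * (real m + 1) powr (- Re r)"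
proof -
  obtain K where K: "- Re a < K" "- Re b < K" "K < Re r"
    using dense[of "max (- Re a) (- Re b)" "Re r"] ra rb by auto
  from hyp2F1_uniform_upper[OF c, of a b] K obtain C where C: "C \<ge> 0" "\<And>m y. y \<ge> 0 \<Longrightarrow>
     cmod (hyp2F1 a b (c + of_nat m) (- complex_of_real y)) \<le> C * (1 + y / (real m + 1)) powr K" by blast
  \<comment> \<open>For \<open>K \<ge> 0\<close> the factor \<open>(1 + y / (m + 1)) powr K\<close> does not fall below \<open>1\<close>; the exponent \<open>L = 0\<close> accounts for this part.\<close>
  define L where "L = min K 0"
  have L: "Re r - L > 0" "Re r - K > 0" using K ra rb by (auto simp: L_def)
  from Beta_upper[OF L(2) c] obtain B1 where B1: "B1 > 0"
    "\<And>n. Beta (Re r - K) (Re c + real n) \<le> B1 * (real n + 1) powr (- (Re r - K))" by blast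
  from Beta_upper[OF L(1) c] obtain B2 where B2: "B2 > 0"
    "\<And>n. Beta (Re r - L) (Re c + real n) \<le> B2 * (real n + 1) powr (- (Re r - L))" by blast
  define D where "D = C * 2 powr \<bar>K\<bar>"
  have D: "D \<ge> 0" using C by (simp add: D_def)
  define g where "g m t = D * ((real m + 1) powr (- K) * (t powr (Re r - K - 1) * (1 - t) powr (Re c + real m - 1)) +
      (real m + 1) powr (- L) * (t powr (Re r - L - 1) * (1 - t) powr (Re c + real m - 1)))" for m t
  have cm: "Re c + real m > 0" for m using c by (simp add: add_pos_nonneg)
  note i1 = beta_integral_real[OF L(2) cm] and i2 = beta_integral_real[OF L(1) cm]
  have gi: "set_integrable lborel {0<..<1} (g m)" for m
    unfolding g_def by (intro set_integrable_mult_right set_integral_add i1 i2)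
  have gv: "(LBINT t:{0<..<1}. g m t) = D * ((real m + 1) powr (- K) * Beta (Re r - K) (Re c + real m) +
      (real m + 1) powr (- L) * Beta (Re r - L) (Re c + real m))" for m
    unfolding g_def
    by (simp only: set_integral_mult_right
         set_integral_add(2)[OF set_integrable_mult_right[OF i1(1)] set_integrable_mult_right[OF i2(1)]] i1(2) i2(2))
  have le: "cmod (mellin_kernel a b (c + of_nat m) r t) \<le> g m t" if t: "t \<in> {0<..<1}" for m t
  proof -
    have "1 / t - 1 \<ge> 0" using t by simp
    from C(2)[OF this, of m] have "cmod (hyp2F1 a b (c + of_nat m) (complex_of_real (1 - 1 / t))) \<le>
        C * (1 + (1 / t - 1) / (real m + 1)) powr K" by simp
    also have "\<dots> \<le> C * (2 powr \<bar>K\<bar> * ((t * (real m + 1)) powr (- K) + (t * (real m + 1)) powr (- L)))"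
      using C t unfolding L_def by (intro mult_left_mono powr_scaled_upper) auto
    also have "\<dots> = D * ((real m + 1) powr (- K) * t powr (- K) + (real m + 1) powr (- L) * t powr (- L))"
      unfolding powr_mult D_def by (simp only: algebra_simps)
    finally have F: "cmod (hyp2F1 a b (c + of_nat m) (complex_of_real (1 - 1 / t))) \<le>
       D * ((real m + 1) powr (- K) * t powr (- K) + (real m + 1) powr (- L) * t powr (- L))" .
    have "cmod (mellin_kernel a b (c + of_nat m) r t) =
       t powr (Re r - 1) * (1 - t) powr (Re c + real m - 1) * cmod (hyp2F1 a b (c + of_nat m) (complex_of_real (1 - 1 / t)))"
      unfolding mellin_kernel_def norm_mult[of "_ * _"] beta_kernel_cmod[OF t] by simp
    also have "\<dots> \<le> t powr (Re r - 1) * (1 - t) powr (Re c + real m - 1) *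
       (D * ((real m + 1) powr (- K) * t powr (- K) + (real m + 1) powr (- L) * t powr (- L)))"
      by (intro mult_left_mono F) auto
    also have "\<dots> = g m t"
    proof -
      have *: "t powr (Re r - u - 1) = t powr (Re r - 1) * t powr (- u)" for u
        by (subst powr_add[symmetric]) (simp add: algebra_simps)
      show ?thesis unfolding g_def * by (simp only: distrib_left mult_ac)
    qed
    finally show ?thesis .
  qed
  have cont: "continuous_on {0<..<1} (mellin_kernel a b (c + of_nat m) r)" for m
    using cm[of m] by (intro continuous_on_mellin_kernel) simp
  show ?thesis
  proof (rule that[of "D * (B1 + B2) + 1"])
    show "D * (B1 + B2) + 1 > 0" using D B1 B2 by (intro add_nonneg_pos mult_nonneg_nonneg) auto
    fix m
    show "set_integrable lborel {0<..<1} (mellin_kernel a b (c + of_nat m) r)"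
      by (rule set_integrable_norm_bound(1)[OF gi cont _ le]) auto
    let ?N = "real m + 1"
    have "(LBINT t:{0<..<1}. cmod (mellin_kernel a b (c + of_nat m) r t)) \<le> (LBINT t:{0<..<1}. g m t)"
      by (rule set_integrable_norm_bound(2)[OF gi cont _ le]) auto
    also have "\<dots> \<le> D * (?N powr (- K) * (B1 * ?N powr (- (Re r - K))) + ?N powr (- L) * (B2 * ?N powr (- (Re r - L))))"
      unfolding gv using D B1 B2 by (intro mult_left_mono add_mono) auto
    also have "\<dots> = D * (B1 * (?N powr (- K) * ?N powr (- (Re r - K))) + B2 * (?N powr (- L) * ?N powr (- (Re r - L))))"
      by (simp only: mult_ac)
    also have "?N powr (- u) * ?N powr (- (Re r - u)) = ?N powr (- Re r)" for u
      by (subst powr_add[symmetric]) simp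
    then have "D * (B1 * (?N powr (- K) * ?N powr (- (Re r - K))) + B2 * (?N powr (- L) * ?N powr (- (Re r - L)))) =
        (D * (B1 + B2)) * ?N powr (- Re r)" by (simp add: algebra_simps)
    also have "\<dots> \<le> (D * (B1 + B2) + 1) * ?N powr (- Re r)"
      by (intro mult_right_mono) auto
    finally show "(LBINT t:{0<..<1}. cmod (mellin_kernel a b (c + of_nat m) r t)) \<le> (D * (B1 + B2) + 1) * ?N powr (- Re r)" .
  qed
qed

text \<open>
  Guarantees convergence of the series for \<open>F3\<close> at each point of the unit interval.
\<close>

lemma hyp2F1_bounded_in_c:
  assumes c: "Re c > 0" and t: "t \<in> {0<..<1}"
  obtains B where "B \<ge> 0" "\<And>m. cmod (hyp2F1 a b (c + of_nat m) (complex_of_real (1 - 1 / t))) \<le> B"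
proof -
  define K where "K = max 0 (max (- Re a) (- Re b)) + 1"
  have "- Re a < K" "- Re b < K" by (auto simp: K_def)
  with hyp2F1_uniform_upper[OF c, of a b] obtain C where C: "C \<ge> 0" "\<And>m y. y \<ge> 0 \<Longrightarrow>
     cmod (hyp2F1 a b (c + of_nat m) (- complex_of_real y)) \<le> C * (1 + y / (real m + 1)) powr K" by blast
  have "cmod (hyp2F1 a b (c + of_nat m) (complex_of_real (1 - 1 / t))) \<le> C * (1 / t) powr K" for m
  proof -
    have y: "1 / t - 1 \<ge> 0" using t by simp
    from C(2)[OF this, of m] have "cmod (hyp2F1 a b (c + of_nat m) (complex_of_real (1 - 1 / t))) \<le>
        C * (1 + (1 / t - 1) / (real m + 1)) powr K" by simp
    also have "\<dots> \<le> C * (1 / t) powr K"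
    proof (intro mult_left_mono powr_mono2)
      have "(1 / t - 1) / (real m + 1) \<le> (1 / t - 1) / 1"
        using y by (intro divide_left_mono) auto
      then show "1 + (1 / t - 1) / (real m + 1) \<le> 1 / t" by simp
      show "0 \<le> 1 + (1 / t - 1) / (real m + 1)" using y by (intro add_nonneg_nonneg divide_nonneg_nonneg) auto
    qed (auto simp: K_def C)
    finally show ?thesis .
  qed
  then show ?thesis using C(1) by (intro that[of "C * (1 / t) powr K"]) auto
qed

section \<open>The image of a power function\<close>

definition power_image :: "complex \<Rightarrow> complex \<Rightarrow> complex \<Rightarrow> complex \<Rightarrow> complex \<Rightarrow> complex \<Rightarrow> complex" where
  "power_image \<alpha> \<alpha>' \<beta> \<beta>' \<gamma> \<rho> =
     Gamma \<rho> * Gamma (\<rho> + \<gamma> - \<alpha> - \<alpha>' - \<beta>) * Gamma (\<rho> + \<beta>' - \<alpha>') *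
     (rGamma (\<rho> + \<beta>') * rGamma (\<rho> + \<gamma> - \<alpha> - \<alpha>') * rGamma (\<rho> + \<gamma> - \<alpha>' - \<beta>))"

text \<open>
  Integrate the series for \<open>F3\<close> termwise. By \<open>mellin_kernel_uniform_integrable\<close> the integrals of the
  absolute values are of order \<open>m powr (- Re (\<rho> + \<gamma> - \<alpha> - \<alpha>' - \<beta>) - 1)\<close>, and the sum of the integrals is
  a Gauss series at \<open>1\<close> with parameters \<open>\<alpha>\<close>, \<open>\<beta>\<close> and \<open>\<gamma> + \<rho> - \<alpha>'\<close>.
\<close>

lemma msm_power_unit:
  assumes g: "Re \<gamma> > 0" and r: "Re \<rho> > 0" "Re (\<rho> + \<beta>' - \<alpha>') > 0" "Re (\<rho> + \<gamma> - \<alpha> - \<alpha>' - \<beta>) > 0"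
  shows "set_integrable lborel {0<..<1} (msm_integrand \<alpha> \<alpha>' \<beta> \<beta>' \<gamma> (\<lambda>t. complex_of_real t powr (\<rho> - 1)) 1)"
    and "(LBINT t:{0<..<1}. msm_integrand \<alpha> \<alpha>' \<beta> \<beta>' \<gamma> (\<lambda>t. complex_of_real t powr (\<rho> - 1)) 1 t) =
           Gamma \<gamma> * power_image \<alpha> \<alpha>' \<beta> \<beta>' \<gamma> \<rho>"
proof -
  define h where "h = gauss_coeff \<alpha> \<beta> \<gamma>"
  define f where "f m t = h m * mellin_kernel \<alpha>' \<beta>' (\<gamma> + of_nat m) (\<rho> - \<alpha>') t" for m t
  let ?I = "msm_integrand \<alpha> \<alpha>' \<beta> \<beta>' \<gamma> (\<lambda>t. complex_of_real t powr (\<rho> - 1)) 1"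
  have gp: "\<gamma> \<notin> \<int>\<^sub>\<le>\<^sub>0" using g by (rule not_nonpos_Int_if_Re_pos)
  have ra: "Re (\<rho> - \<alpha>' + \<alpha>') > 0" "Re (\<rho> - \<alpha>' + \<beta>') > 0" using r by auto
  have gm: "Re (\<gamma> + of_nat m) > 0" for m using g by (simp add: add_pos_nonneg)
  from mellin_kernel_uniform_integrable[OF g ra] obtain C where C: "C > 0"
    "\<And>m. set_integrable lborel {0<..<1} (mellin_kernel \<alpha>' \<beta>' (\<gamma> + of_nat m) (\<rho> - \<alpha>'))"
    "\<And>m. (LBINT t:{0<..<1}. cmod (mellin_kernel \<alpha>' \<beta>' (\<gamma> + of_nat m) (\<rho> - \<alpha>') t)) \<le> C * (real m + 1) powr (- Re (\<rho> - \<alpha>'))"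
    by blast
  from gauss_coeff_upper[OF gp] obtain A where A: "A > 0"
    "\<And>m. cmod (h m) \<le> A * (real m + 1) powr (Re (\<alpha> + \<beta> - \<gamma>) - 1)" unfolding h_def by blast
  have f_eq: "f m t = (complex_of_real t powr (\<rho> - \<alpha>' - 1) * complex_of_real (1 - t) powr (\<gamma> - 1)) *
       (h m * complex_of_real (1 - t) ^ m * hyp2F1 \<alpha>' \<beta>' (\<gamma> + of_nat m) (complex_of_real (1 - 1 / t)))"
    and sm: "summable (\<lambda>m. cmod (h m * complex_of_real (1 - t) ^ m * hyp2F1 \<alpha>' \<beta>' (\<gamma> + of_nat m) (complex_of_real (1 - 1 / t))))"
    if t: "t \<in> {0<..<1}" for m t
  proof -
    have "complex_of_real (1 - t) \<noteq> 0" using t by (simp del: of_real_diff)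
    then have "complex_of_real (1 - t) powr (\<gamma> + of_nat m - 1) = complex_of_real (1 - t) powr (\<gamma> - 1) * complex_of_real (1 - t) ^ m"
      using powr_add[of "complex_of_real (1 - t)" "\<gamma> - 1" "of_nat m"] by (simp add: algebra_simps del: of_real_diff)
    then show "f m t = (complex_of_real t powr (\<rho> - \<alpha>' - 1) * complex_of_real (1 - t) powr (\<gamma> - 1)) *
       (h m * complex_of_real (1 - t) ^ m * hyp2F1 \<alpha>' \<beta>' (\<gamma> + of_nat m) (complex_of_real (1 - 1 / t)))"
      unfolding f_def mellin_kernel_def by (simp only: mult_ac)
    from hyp2F1_bounded_in_c[OF g t, of \<alpha>' \<beta>'] obtain B where B: "B \<ge> 0"
      "\<And>m. cmod (hyp2F1 \<alpha>' \<beta>' (\<gamma> + of_nat m) (complex_of_real (1 - 1 / t))) \<le> B" by blast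
    have "summable (\<lambda>m. cmod (h m * complex_of_real (1 - t) ^ m) * B)"
      unfolding h_def using t gp by (intro summable_mult2 summable_gauss_coeff) (auto simp del: of_real_diff)
    then show "summable (\<lambda>m. cmod (h m * complex_of_real (1 - t) ^ m * hyp2F1 \<alpha>' \<beta>' (\<gamma> + of_nat m) (complex_of_real (1 - 1 / t))))"
    proof (rule summable_comparison_test')
      fix m
      show "norm (cmod (h m * complex_of_real (1 - t) ^ m * hyp2F1 \<alpha>' \<beta>' (\<gamma> + of_nat m) (complex_of_real (1 - 1 / t)))) \<le>
          cmod (h m * complex_of_real (1 - t) ^ m) * B"
        unfolding norm_mult[of "_ * _" "hyp2F1 _ _ _ _"] real_norm_def abs_mult abs_norm_cancel
        by (intro mult_left_mono B) auto
    qed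
  qed
  have fsum: "(\<Sum>m. f m t) = ?I t" if t: "t \<in> {0<..<1}" for t
  proof -
    have "(\<Sum>m. f m t) = (complex_of_real t powr (\<rho> - \<alpha>' - 1) * complex_of_real (1 - t) powr (\<gamma> - 1)) *
       (\<Sum>m. h m * complex_of_real (1 - t) ^ m * hyp2F1 \<alpha>' \<beta>' (\<gamma> + of_nat m) (complex_of_real (1 - 1 / t)))"
      unfolding f_eq[OF t] by (rule suminf_mult[OF summable_norm_cancel[OF sm[OF t]]])
    also have "(\<Sum>m. h m * complex_of_real (1 - t) ^ m * hyp2F1 \<alpha>' \<beta>' (\<gamma> + of_nat m) (complex_of_real (1 - 1 / t))) =
      appell_F3 \<alpha> \<alpha>' \<beta> \<beta>' \<gamma> (complex_of_real (1 - t / 1)) (complex_of_real (1 - 1 / t))"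
      by (simp add: appell_F3_def h_def gauss_coeff_def)
    also have "complex_of_real t powr (\<rho> - \<alpha>' - 1) = complex_of_real t powr (- \<alpha>') * complex_of_real t powr (\<rho> - 1)"
      by (subst powr_add[symmetric]) (simp add: algebra_simps)
    finally show ?thesis unfolding msm_integrand_def by (simp only: mult_ac)
  qed
  have fi: "set_integrable lborel {0<..<1} (f m)" for m
    unfolding f_def by (intro set_integrable_mult_right C)
  have fsm: "summable (\<lambda>m. cmod (f m t))" if "t \<in> {0<..<1}" for t
    unfolding f_eq[OF that] norm_mult[of "_ powr _ * _" "_ * _"] by (intro summable_mult sm that)
  have fb: "(LBINT t:{0<..<1}. cmod (f m t)) \<le> (A * C) * (real m + 1) powr (- Re (\<rho> + \<gamma> - \<alpha> - \<alpha>' - \<beta>) - 1)" for m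
  proof -
    have "(LBINT t:{0<..<1}. cmod (f m t)) = cmod (h m) * (LBINT t:{0<..<1}. cmod (mellin_kernel \<alpha>' \<beta>' (\<gamma> + of_nat m) (\<rho> - \<alpha>') t))"
      unfolding f_def norm_mult set_integral_mult_right ..
    also have "\<dots> \<le> (A * (real m + 1) powr (Re (\<alpha> + \<beta> - \<gamma>) - 1)) * (C * (real m + 1) powr (- Re (\<rho> - \<alpha>')))"
      using A by (intro mult_mono A C) (auto simp: set_lebesgue_integral_def)
    also have "\<dots> = (A * C) * ((real m + 1) powr (Re (\<alpha> + \<beta> - \<gamma>) - 1) * (real m + 1) powr (- Re (\<rho> - \<alpha>')))"
      by (simp only: mult_ac)
    also have "(real m + 1) powr (Re (\<alpha> + \<beta> - \<gamma>) - 1) * (real m + 1) powr (- Re (\<rho> - \<alpha>')) = (real m + 1) powr (- Re (\<rho> + \<gamma> - \<alpha> - \<alpha>' - \<beta>) - 1)"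
      by (subst powr_add[symmetric], rule arg_cong[where f = "\<lambda>u. (real m + 1) powr u"]) simp
    finally show ?thesis .
  qed
  have bs: "summable (\<lambda>m. (A * C) * (real m + 1) powr (- Re (\<rho> + \<gamma> - \<alpha> - \<alpha>' - \<beta>) - 1))"
    using r by (intro summable_mult summable_Suc_powr) auto
  note res = set_integral_suminf[of "{0<..<1}" f, OF fi fsm fb bs]
  have "set_integrable lborel {0<..<1} (\<lambda>t. \<Sum>m. f m t) = set_integrable lborel {0<..<1} ?I"
    by (intro set_integrable_cong) (auto simp: fsum)
  with res(1) show "set_integrable lborel {0<..<1} ?I" by simp
  have "(LBINT t:{0<..<1}. \<Sum>m. f m t) = (LBINT t:{0<..<1}. ?I t)"
    by (intro set_lebesgue_integral_cong) (auto simp: fsum)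
  with res(2) have 1: "(\<lambda>m. LBINT t:{0<..<1}. f m t) sums (LBINT t:{0<..<1}. ?I t)" by simp
  define Q where "Q = Gamma \<gamma> * Gamma \<rho> * Gamma (\<rho> + \<beta>' - \<alpha>') * rGamma (\<rho> + \<beta>')"
  have 2: "(LBINT t:{0<..<1}. f m t) = Q *
      (pochhammer \<alpha> m * pochhammer \<beta> m * rGamma (\<gamma> + \<rho> - \<alpha>' + of_nat m) / fact m)" for m
  proof -
    have "(LBINT t:{0<..<1}. f m t) = h m * (Gamma (\<gamma> + of_nat m) * Gamma (\<rho> - \<alpha>' + \<alpha>') * Gamma (\<rho> - \<alpha>' + \<beta>') *
        rGamma (\<gamma> + of_nat m + (\<rho> - \<alpha>')) * rGamma (\<rho> - \<alpha>' + \<alpha>' + \<beta>'))"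
      unfolding f_def set_integral_mult_right hyp2F1_beta_transform[OF gm ra] ..
    moreover have "Gamma (\<gamma> + of_nat m) = pochhammer \<gamma> m * Gamma \<gamma>"
      using pochhammer_Gamma[OF gp, of m] gp by (simp add: Gamma_eq_zero_iff)
    moreover have "pochhammer \<gamma> m \<noteq> 0" using gp by (auto simp: pochhammer_eq_0_iff)
    moreover have "\<gamma> + of_nat m + (\<rho> - \<alpha>') = \<gamma> + \<rho> - \<alpha>' + of_nat m" "\<rho> - \<alpha>' + \<beta>' = \<rho> + \<beta>' - \<alpha>'" by simp_all
    ultimately show ?thesis by (simp add: h_def gauss_coeff_def Q_def)
  qed
  have "Re (\<gamma> + \<rho> - \<alpha>' - \<alpha> - \<beta>) > 0" using r by simp
  from sums_mult[OF gauss_summation[OF this], of Q]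
  have "(\<lambda>m. LBINT t:{0<..<1}. f m t) sums (Q * (Gamma (\<gamma> + \<rho> - \<alpha>' - \<alpha> - \<beta>) * rGamma (\<gamma> + \<rho> - \<alpha>' - \<alpha>) * rGamma (\<gamma> + \<rho> - \<alpha>' - \<beta>)))"
    unfolding 2 .
  with 1 have "(LBINT t:{0<..<1}. ?I t) = Q * (Gamma (\<gamma> + \<rho> - \<alpha>' - \<alpha> - \<beta>) * rGamma (\<gamma> + \<rho> - \<alpha>' - \<alpha>) * rGamma (\<gamma> + \<rho> - \<alpha>' - \<beta>))"
    by (rule sums_unique2)
  moreover have "\<gamma> + \<rho> - \<alpha>' - \<alpha> - \<beta> = \<rho> + \<gamma> - \<alpha> - \<alpha>' - \<beta>" "\<gamma> + \<rho> - \<alpha>' - \<alpha> = \<rho> + \<gamma> - \<alpha> - \<alpha>'"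
    "\<gamma> + \<rho> - \<alpha>' - \<beta> = \<rho> + \<gamma> - \<alpha>' - \<beta>" by simp_all
  ultimately show "(LBINT t:{0<..<1}. ?I t) = Gamma \<gamma> * power_image \<alpha> \<alpha>' \<beta> \<beta>' \<gamma> \<rho>"
    by (simp only: Q_def power_image_def mult_ac)
qed

lemma set_integral_rescale:
  fixes h :: "real \<Rightarrow> complex"
  assumes "x > 0"
  shows "set_integrable lborel {0<..<x} h \<longleftrightarrow> set_integrable lborel {0<..<1} (\<lambda>s. h (x * s))"
    and "(LBINT t:{0<..<x}. h t) = x * (LBINT s:{0<..<1}. h (x * s))"
proof -
  have ind: "indicat_real {0<..<x} (0 + x * s) *\<^sub>R h (0 + x * s) = indicat_real {0<..<1} s *\<^sub>R h (x * s)" for s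
    using assms by (auto simp: indicator_def zero_less_mult_iff)
  show "set_integrable lborel {0<..<x} h \<longleftrightarrow> set_integrable lborel {0<..<1} (\<lambda>s. h (x * s))"
    unfolding set_integrable_def ind[symmetric] using assms by (subst lborel_integrable_real_affine_iff) auto
  show "(LBINT t:{0<..<x}. h t) = x * (LBINT s:{0<..<1}. h (x * s))"
    unfolding set_lebesgue_integral_def ind[symmetric]
    using assms by (subst lborel_integral_real_affine[of x _ 0]) (auto simp: scaleR_conv_of_real)
qed

lemma powr_mult_pos_reals:
  assumes "x > 0" "y > 0"
  shows "complex_of_real (x * y) powr a = complex_of_real x powr a * complex_of_real y powr a"
  using assms by (simp add: powr_def Ln_of_real ln_mult exp_add[symmetric] algebra_simps del: of_real_mult)

lemma msm_integrand_rescale: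
  assumes x: "x > 0" and s: "s \<in> {0<..<1}"
  shows "msm_integrand \<alpha> \<alpha>' \<beta> \<beta>' \<gamma> (\<lambda>t. complex_of_real t powr (\<rho> - 1)) x (x * s) =
     complex_of_real x powr (\<gamma> - 1 - \<alpha>' + (\<rho> - 1)) *
       msm_integrand \<alpha> \<alpha>' \<beta> \<beta>' \<gamma> (\<lambda>t. complex_of_real t powr (\<rho> - 1)) 1 s"
proof -
  have "x - x * s = x * (1 - s)" by (simp add: algebra_simps)
  moreover have "complex_of_real (x * (1 - s)) powr (\<gamma> - 1) = complex_of_real x powr (\<gamma> - 1) * complex_of_real (1 - s) powr (\<gamma> - 1)"
    using x s by (intro powr_mult_pos_reals) auto
  moreover have "complex_of_real (x * s) powr u = complex_of_real x powr u * complex_of_real s powr u" for u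
    using x s by (intro powr_mult_pos_reals) auto
  moreover have "x * s / x = s / 1" "x / (x * s) = 1 / s" using x by simp_all
  moreover have "complex_of_real x powr (\<gamma> - 1 - \<alpha>' + (\<rho> - 1)) =
      complex_of_real x powr (\<gamma> - 1) * complex_of_real x powr (- \<alpha>') * complex_of_real x powr (\<rho> - 1)"
    by (simp add: powr_add[symmetric] algebra_simps)
  ultimately show ?thesis unfolding msm_integrand_def by (simp only: mult_ac)
qed

theorem msm_power:
  assumes "Re \<gamma> > 0" "Re \<rho> > 0" "Re (\<rho> + \<beta>' - \<alpha>') > 0" "Re (\<rho> + \<gamma> - \<alpha> - \<alpha>' - \<beta>) > 0" and x: "x > 0"
  shows "set_integrable lborel {0<..<x} (msm_integrand \<alpha> \<alpha>' \<beta> \<beta>' \<gamma> (\<lambda>t. complex_of_real t powr (\<rho> - 1)) x)"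
    and "(LBINT t:{0<..<x}. msm_integrand \<alpha> \<alpha>' \<beta> \<beta>' \<gamma> (\<lambda>t. complex_of_real t powr (\<rho> - 1)) x t) =
           Gamma \<gamma> * complex_of_real x powr (\<rho> + \<gamma> - \<alpha>' - 1) * power_image \<alpha> \<alpha>' \<beta> \<beta>' \<gamma> \<rho>"
proof -
  let ?I = "\<lambda>x. msm_integrand \<alpha> \<alpha>' \<beta> \<beta>' \<gamma> (\<lambda>t. complex_of_real t powr (\<rho> - 1)) x"
  let ?X = "complex_of_real x powr (\<gamma> - 1 - \<alpha>' + (\<rho> - 1))"
  note unit = msm_power_unit[OF assms(1-4)]
  have eq: "?I x (x * s) = ?X * ?I 1 s" if "s \<in> {0<..<1}" for s
    using x that by (rule msm_integrand_rescale)
  have "set_integrable lborel {0<..<1} (\<lambda>s. ?I x (x * s)) = set_integrable lborel {0<..<1} (\<lambda>s. ?X * ?I 1 s)"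
    by (intro set_integrable_cong) (auto simp: eq)
  then show "set_integrable lborel {0<..<x} (?I x)"
    unfolding set_integral_rescale(1)[OF x] using set_integrable_mult_right[OF unit(1)] by simp
  have "(LBINT t:{0<..<x}. ?I x t) = x * (LBINT s:{0<..<1}. ?X * ?I 1 s)"
    unfolding set_integral_rescale(2)[OF x]
    by (intro arg_cong2[where f = "(*)"] refl set_lebesgue_integral_cong) (auto simp: eq)
  also have "\<dots> = (complex_of_real x * ?X) * (Gamma \<gamma> * power_image \<alpha> \<alpha>' \<beta> \<beta>' \<gamma> \<rho>)"
    unfolding set_integral_mult_right unit(2) by simp
  also have "complex_of_real x * ?X = complex_of_real x powr (1 + (\<gamma> - 1 - \<alpha>' + (\<rho> - 1)))"
    using x by (subst powr_add) simp
  also have "1 + (\<gamma> - 1 - \<alpha>' + (\<rho> - 1)) = \<rho> + \<gamma> - \<alpha>' - 1" by simp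
  finally show "(LBINT t:{0<..<x}. ?I x t) = Gamma \<gamma> * complex_of_real x powr (\<rho> + \<gamma> - \<alpha>' - 1) * power_image \<alpha> \<alpha>' \<beta> \<beta>' \<gamma> \<rho>"
    by (simp only: mult_ac)
qed

section \<open>The image of the generalized Bessel function\<close>

lemma pochhammer_even:
  fixes z :: complex
  shows "pochhammer z (2 * k) = 4 ^ k * (pochhammer (z / 2) k * pochhammer ((z + 1) / 2) k)"
  using pochhammer_double[of "z / 2" k] by (simp add: add_divide_distrib power_mult)

lemma power_image_shift:
  assumes "\<rho> \<notin> \<int>\<^sub>\<le>\<^sub>0" "\<rho> + \<gamma> - \<alpha> - \<alpha>' - \<beta> \<notin> \<int>\<^sub>\<le>\<^sub>0" "\<rho> + \<beta>' - \<alpha>' \<notin> \<int>\<^sub>\<le>\<^sub>0"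
    "\<rho> + \<beta>' \<notin> \<int>\<^sub>\<le>\<^sub>0" "\<rho> + \<gamma> - \<alpha> - \<alpha>' \<notin> \<int>\<^sub>\<le>\<^sub>0" "\<rho> + \<gamma> - \<alpha>' - \<beta> \<notin> \<int>\<^sub>\<le>\<^sub>0"
  shows "power_image \<alpha> \<alpha>' \<beta> \<beta>' \<gamma> (\<rho> + of_nat n) =
    power_image \<alpha> \<alpha>' \<beta> \<beta>' \<gamma> \<rho> *
     (pochhammer \<rho> n * pochhammer (\<rho> + \<gamma> - \<alpha> - \<alpha>' - \<beta>) n * pochhammer (\<rho> + \<beta>' - \<alpha>') n /
      (pochhammer (\<rho> + \<beta>') n * pochhammer (\<rho> + \<gamma> - \<alpha> - \<alpha>') n * pochhammer (\<rho> + \<gamma> - \<alpha>' - \<beta>) n))"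
proof -
  have G: "Gamma (z + of_nat n) = Gamma z * pochhammer z n" if "z \<notin> \<int>\<^sub>\<le>\<^sub>0" for z :: complex
    using pochhammer_Gamma[OF that, of n] that by (simp add: Gamma_eq_zero_iff)
  have R: "rGamma (z + of_nat n) = rGamma z / pochhammer z n" if "z \<notin> \<int>\<^sub>\<le>\<^sub>0" for z :: complex
  proof -
    have "pochhammer z n \<noteq> 0" using that by (auto simp: pochhammer_eq_0_iff)
    then show ?thesis using pochhammer_rGamma[of z n] by simp
  qed
  have e: "\<rho> + of_nat n + \<gamma> - \<alpha> - \<alpha>' - \<beta> = \<rho> + \<gamma> - \<alpha> - \<alpha>' - \<beta> + of_nat n"
    "\<rho> + of_nat n + \<beta>' - \<alpha>' = \<rho> + \<beta>' - \<alpha>' + of_nat n" "\<rho> + of_nat n + \<beta>' = \<rho> + \<beta>' + of_nat n"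
    "\<rho> + of_nat n + \<gamma> - \<alpha> - \<alpha>' = \<rho> + \<gamma> - \<alpha> - \<alpha>' + of_nat n"
    "\<rho> + of_nat n + \<gamma> - \<alpha>' - \<beta> = \<rho> + \<gamma> - \<alpha>' - \<beta> + of_nat n" by simp_all
  show ?thesis
    unfolding power_image_def unfolding e(1) unfolding e(2) unfolding e(3) unfolding e(4) unfolding e(5)
    unfolding G[OF assms(1)] G[OF assms(2)] G[OF assms(3)] R[OF assms(4)] R[OF assms(5)] R[OF assms(6)]
    by simp
qed

text \<open>
  The coefficients of \<open>gen_bessel p b c z\<close> with respect to \<open>z powr (2 * k + p)\<close>.
\<close>

definition bessel_coeff :: "complex \<Rightarrow> complex \<Rightarrow> complex \<Rightarrow> nat \<Rightarrow> complex" where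
  "bessel_coeff p b c k = (- c / 4) ^ k * rGamma (p + (b + 1) / 2 + of_nat k) / (2 powr p * fact k)"

lemma bessel_coeff_summable:
  assumes "R \<ge> 0"
  shows "summable (\<lambda>k. cmod (bessel_coeff p b c k) * R ^ k)"
proof -
  define \<kappa> where "\<kappa> = p + (b + 1) / 2"
  \<comment> \<open>The ratio is \<open>2\<close> times \<open>cmod c * R / 4\<close>, which leaves a factor \<open>(1/2) ^ k\<close> to absorb the power of \<open>k\<close>.\<close>
  define q where "q = cmod c * R / 2"
  have q: "q \<ge> 0" using assms by (simp add: q_def)
  from rGamma_upper[of \<kappa>] obtain C where C: "C > 0"
    "\<And>k. cmod (rGamma (\<kappa> + of_nat k)) \<le> C * ((real k + 1) powr (1 - Re \<kappa>) / fact k)" by blast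
  have "Bseq (\<lambda>k. q ^ k / fact k)"
    using summable_LIMSEQ_zero[OF summable_exp[of q]]
    by (intro convergent_imp_Bseq convergentI[of _ 0]) (simp add: field_simps)
  then obtain B where B: "B > 0" "\<And>k. norm (q ^ k / fact k) \<le> B" by (auto simp: Bseq_def)
  show ?thesis
  proof (rule summable_comparison_test'[OF summable_mult[OF summable_Suc_powr_power]])
    fix k
    have "cmod (bessel_coeff p b c k) * R ^ k =
       cmod (rGamma (\<kappa> + of_nat k)) * ((1 / 2) ^ k * (q ^ k / fact k)) / cmod (2 powr p)"
    proof -
      have "(4::real) ^ k = 2 ^ k * 2 ^ k" by (simp flip: power_mult_distrib)
      then show ?thesis
        by (simp add: bessel_coeff_def \<kappa>_def[symmetric] norm_mult norm_divide norm_power q_def power_divide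
              power_mult_distrib mult_ac)
    qed
    also have "\<dots> \<le> (C * (real k + 1) powr (1 - Re \<kappa>)) * ((1 / 2) ^ k * B) / cmod (2 powr p)"
    proof (intro divide_right_mono mult_mono mult_left_mono)
      have "cmod (rGamma (\<kappa> + of_nat k)) \<le> C * ((real k + 1) powr (1 - Re \<kappa>) / fact k)" by (rule C)
      also have "\<dots> \<le> C * ((real k + 1) powr (1 - Re \<kappa>) / 1)"
        using C by (intro mult_left_mono divide_left_mono) (auto simp: fact_ge_1)
      finally show "cmod (rGamma (\<kappa> + of_nat k)) \<le> C * (real k + 1) powr (1 - Re \<kappa>)" by simp
      show "q ^ k / fact k \<le> B" using B(2)[of k] q by simp
    qed (use C B q in auto)
    finally show "norm (cmod (bessel_coeff p b c k) * R ^ k) \<le>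
        C * B / cmod (2 powr p) * ((real k + 1) powr (1 - Re \<kappa>) * (1 / 2) ^ k)"
      using assms by (simp add: mult_ac)
  qed auto
qed

lemma bessel_term:
  assumes "t > 0"
  shows "complex_of_real t powr (\<rho> - 1) * ((-1) ^ k * c ^ k / (Gamma (p + (b + 1) / 2 + of_nat k) * fact k) *
           (complex_of_real t / 2) powr (2 * of_nat k + p)) =
         bessel_coeff p b c k * complex_of_real t powr (\<rho> + p + of_nat (2 * k) - 1)"
proof -
  have "(complex_of_real t / 2) powr (2 * of_nat k + p) = complex_of_real (t * (1 / 2)) powr (of_nat (2 * k) + p)"
    by simp
  also have "\<dots> = complex_of_real t powr (of_nat (2 * k) + p) * complex_of_real (1 / 2) powr (of_nat (2 * k) + p)"
    using assms by (intro powr_mult_pos_reals) auto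
  also have "complex_of_real (1 / 2) powr (of_nat (2 * k) + p) = 1 / (4 ^ k * 2 powr p)"
  proof -
    have "complex_of_real (1 / 2) powr p = 1 / 2 powr p"
    proof -
      have "complex_of_real (1 / 2) powr p * complex_of_real 2 powr p = complex_of_real (1 / 2 * 2) powr p"
        by (rule powr_mult_pos_reals[symmetric]) auto
      then show ?thesis by (simp add: field_simps)
    qed
    moreover have "complex_of_real (1 / 2) powr of_nat (2 * k) = 1 / 4 ^ k"
      by (subst powr_complexpow) (simp_all add: power_mult power_divide power2_eq_square)
    ultimately show ?thesis by (simp add: powr_add)
  qed
  finally have 1: "(complex_of_real t / 2) powr (2 * of_nat k + p) =
      complex_of_real t powr (of_nat (2 * k) + p) * (1 / (4 ^ k * 2 powr p))" .
  have 2: "complex_of_real t powr (\<rho> + p + of_nat (2 * k) - 1) = complex_of_real t powr (\<rho> - 1) * complex_of_real t powr (of_nat (2 * k) + p)"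
    by (subst powr_add[symmetric]) (simp add: algebra_simps)
  have 3: "(- c / 4) ^ k = (-1) ^ k * c ^ k / 4 ^ k"
    unfolding power_divide power_mult_distrib[symmetric] by simp
  show ?thesis
    unfolding 1 2 3 bessel_coeff_def rGamma_inverse_Gamma by (simp add: divide_simps)
qed

text \<open>
  On the interval the \<open>k\<close>-th integrand is at most \<open>x ^ (2 * k)\<close> times the modulus of the \<open>k\<close>-th coefficient times
  the zeroth power integrand, which is integrable.
\<close>

lemma msm_bessel:
  fixes \<alpha> \<alpha>' \<beta> \<beta>' \<gamma> \<rho> p b c :: complex and x :: real
  assumes g: "Re \<gamma> > 0" and r: "Re (\<rho> + p) > 0" "Re (\<rho> + p + \<beta>' - \<alpha>') > 0" "Re (\<rho> + p + \<gamma> - \<alpha> - \<alpha>' - \<beta>) > 0"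
    and x: "x > 0"
  defines "W \<equiv> \<lambda>t. complex_of_real t powr (\<rho> - 1) * gen_bessel p b c (complex_of_real t)"
  shows "set_integrable lborel {0<..<x} (msm_integrand \<alpha> \<alpha>' \<beta> \<beta>' \<gamma> W x)"
    and "(\<lambda>k. bessel_coeff p b c k * (Gamma \<gamma> * complex_of_real x powr (\<rho> + p + of_nat (2 * k) + \<gamma> - \<alpha>' - 1) *
             power_image \<alpha> \<alpha>' \<beta> \<beta>' \<gamma> (\<rho> + p + of_nat (2 * k)))) sums
           (LBINT t:{0<..<x}. msm_integrand \<alpha> \<alpha>' \<beta> \<beta>' \<gamma> W x t)"
proof -
  define P where "P k = msm_integrand \<alpha> \<alpha>' \<beta> \<beta>' \<gamma> (\<lambda>t. complex_of_real t powr (\<rho> + p + of_nat (2 * k) - 1)) x" for k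
  define f where "f k t = bessel_coeff p b c k * P k t" for k t
  have P: "set_integrable lborel {0<..<x} (P k)"
    "(LBINT t:{0<..<x}. P k t) = Gamma \<gamma> * complex_of_real x powr (\<rho> + p + of_nat (2 * k) + \<gamma> - \<alpha>' - 1) *
             power_image \<alpha> \<alpha>' \<beta> \<beta>' \<gamma> (\<rho> + p + of_nat (2 * k))" for k
  proof -
    have "Re (\<rho> + p + of_nat (2 * k)) > 0" "Re (\<rho> + p + of_nat (2 * k) + \<beta>' - \<alpha>') > 0"
      "Re (\<rho> + p + of_nat (2 * k) + \<gamma> - \<alpha> - \<alpha>' - \<beta>) > 0"
      using r by auto
    from msm_power[OF g this x] show "set_integrable lborel {0<..<x} (P k)"
    "(LBINT t:{0<..<x}. P k t) = Gamma \<gamma> * complex_of_real x powr (\<rho> + p + of_nat (2 * k) + \<gamma> - \<alpha>' - 1) *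
             power_image \<alpha> \<alpha>' \<beta> \<beta>' \<gamma> (\<rho> + p + of_nat (2 * k))"
      unfolding P_def by auto
  qed
  have P_eq: "P k t = P 0 t * complex_of_real t ^ (2 * k)" if "t \<in> {0<..<x}" for k t
  proof -
    have "complex_of_real t powr (\<rho> + p + of_nat (2 * k) - 1) = complex_of_real t powr (\<rho> + p - 1) * complex_of_real t powr of_nat (2 * k)"
      by (subst powr_add[symmetric]) (simp add: algebra_simps)
    also have "complex_of_real t powr of_nat (2 * k) = complex_of_real t ^ (2 * k)"
      using that by (intro powr_complexpow) auto
    finally show ?thesis by (simp add: P_def msm_integrand_def)
  qed
  have le: "cmod (f k t) \<le> cmod (bessel_coeff p b c k) * (x\<^sup>2) ^ k * cmod (P 0 t)" if t: "t \<in> {0<..<x}" for k t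
  proof -
    have "cmod (f k t) = cmod (bessel_coeff p b c k) * t ^ (2 * k) * cmod (P 0 t)"
      using t P_eq[OF t, of k] by (simp add: f_def norm_mult norm_power)
    also have "\<dots> \<le> cmod (bessel_coeff p b c k) * x ^ (2 * k) * cmod (P 0 t)"
      using t by (intro mult_right_mono mult_left_mono power_mono) auto
    finally show ?thesis by (simp add: power_mult)
  qed
  have bs: "summable (\<lambda>k. cmod (bessel_coeff p b c k) * (x\<^sup>2) ^ k * B)" for B
    by (intro summable_mult2 bessel_coeff_summable) simp
  have fi: "set_integrable lborel {0<..<x} (f k)" for k
    unfolding f_def by (intro set_integrable_mult_right P)
  have fsm: "summable (\<lambda>k. cmod (f k t))" if "t \<in> {0<..<x}" for t
    by (rule summable_comparison_test'[OF bs[of "cmod (P 0 t)"]]) (use le[OF that] in simp)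
  have fb: "(LBINT t:{0<..<x}. cmod (f k t)) \<le> cmod (bessel_coeff p b c k) * (x\<^sup>2) ^ k * (LBINT t:{0<..<x}. cmod (P 0 t))" for k
    unfolding set_integral_mult_right[symmetric]
    by (intro set_integral_mono set_integrable_norm fi set_integrable_mult_right P le)
  note res = set_integral_suminf[of "{0<..<x}" f, OF fi fsm fb bs]
  have fsum: "(\<Sum>k. f k t) = msm_integrand \<alpha> \<alpha>' \<beta> \<beta>' \<gamma> W x t" if t: "t \<in> {0<..<x}" for t
  proof -
    define E where "E = msm_integrand \<alpha> \<alpha>' \<beta> \<beta>' \<gamma> (\<lambda>_. 1) x t"
    have E: "msm_integrand \<alpha> \<alpha>' \<beta> \<beta>' \<gamma> f x t = E * f t" for f
      by (simp add: E_def msm_integrand_def)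
    define w where "w k = (-1) ^ k * c ^ k / (Gamma (p + (b + 1) / 2 + of_nat k) * fact k) *
           (complex_of_real t / 2) powr (2 * of_nat k + p)" for k
    have tm: "complex_of_real t powr (\<rho> - 1) * w k = bessel_coeff p b c k * complex_of_real t powr (\<rho> + p + of_nat (2 * k) - 1)" for k
      unfolding w_def using t by (intro bessel_term) auto
    have "summable (\<lambda>k. cmod (complex_of_real t powr (\<rho> - 1) * w k))"
    proof -
      have "cmod (complex_of_real t powr (\<rho> - 1) * w k) = cmod (complex_of_real t powr (\<rho> + p - 1)) * (cmod (bessel_coeff p b c k) * (t\<^sup>2) ^ k)" for k
      proof -
        have "complex_of_real t powr (\<rho> + p + of_nat (2 * k) - 1) = complex_of_real t powr (\<rho> + p - 1) * complex_of_real t powr of_nat (2 * k)"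
          by (subst powr_add[symmetric]) (simp add: algebra_simps)
        also have "complex_of_real t powr of_nat (2 * k) = complex_of_real t ^ (2 * k)"
          using t by (intro powr_complexpow) auto
        finally show ?thesis unfolding tm using t by (simp add: norm_mult norm_power power_mult)
      qed
      then show ?thesis by (simp only:) (intro summable_mult bessel_coeff_summable, simp)
    qed
    then have "summable (\<lambda>k. complex_of_real t powr (\<rho> - 1) * w k)" by (rule summable_norm_cancel)
    then have sw: "summable w" using t by (simp add: summable_cmult_iff)
    have "(\<Sum>k. f k t) = (\<Sum>k. (E * complex_of_real t powr (\<rho> - 1)) * w k)"
      by (intro suminf_cong) (simp add: f_def P_def E mult.assoc tm mult.left_commute)
    also have "\<dots> = (E * complex_of_real t powr (\<rho> - 1)) * (\<Sum>k. w k)"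
      by (rule suminf_mult[OF sw])
    also have "(\<Sum>k. w k) = gen_bessel p b c (complex_of_real t)"
      by (simp add: gen_bessel_def w_def)
    finally show ?thesis by (simp add: E W_def)
  qed
  have "set_integrable lborel {0<..<x} (\<lambda>t. \<Sum>k. f k t) = set_integrable lborel {0<..<x} (msm_integrand \<alpha> \<alpha>' \<beta> \<beta>' \<gamma> W x)"
    by (intro set_integrable_cong) (auto simp: fsum)
  with res(1) show "set_integrable lborel {0<..<x} (msm_integrand \<alpha> \<alpha>' \<beta> \<beta>' \<gamma> W x)" by simp
  have "(LBINT t:{0<..<x}. \<Sum>k. f k t) = (LBINT t:{0<..<x}. msm_integrand \<alpha> \<alpha>' \<beta> \<beta>' \<gamma> W x t)"
    by (intro set_lebesgue_integral_cong) (auto simp: fsum)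
  with res(2) show "(\<lambda>k. bessel_coeff p b c k * (Gamma \<gamma> * complex_of_real x powr (\<rho> + p + of_nat (2 * k) + \<gamma> - \<alpha>' - 1) *
             power_image \<alpha> \<alpha>' \<beta> \<beta>' \<gamma> (\<rho> + p + of_nat (2 * k)))) sums
           (LBINT t:{0<..<x}. msm_integrand \<alpha> \<alpha>' \<beta> \<beta>' \<gamma> W x t)"
    unfolding f_def set_integral_mult_right P(2) by simp
qed

theorem theorem3p1:
  fixes \<alpha> \<alpha>' \<beta> \<beta>' \<gamma> \<rho> p b c \<kappa> :: complex and x :: real
  assumes "\<kappa> = p + (b + 1) / 2"
    and "\<kappa> \<notin> \<int>\<^sub>\<le>\<^sub>0"
    and "Re \<gamma> > 0"
    and "Re (\<rho> + p) > Max {0, Re (\<alpha> + \<alpha>' + \<beta> - \<gamma>), Re (\<alpha>' - \<beta>')}"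
    and "\<rho> + p + \<beta>' \<notin> \<int>\<^sub>\<le>\<^sub>0"
    and "\<rho> + p + \<gamma> - \<alpha> - \<alpha>' \<notin> \<int>\<^sub>\<le>\<^sub>0"
    and "\<rho> + p + \<gamma> - \<alpha>' - \<beta> \<notin> \<int>\<^sub>\<le>\<^sub>0"
    and "x > 0"
  shows "set_integrable lborel {0<..<x} (msm_integrand \<alpha> \<alpha>' \<beta> \<beta>' \<gamma>
           (\<lambda>t. complex_of_real t powr (\<rho> - 1) * gen_bessel p b c (complex_of_real t)) x)
       \<and> msm_integral \<alpha> \<alpha>' \<beta> \<beta>' \<gamma>
           (\<lambda>t. complex_of_real t powr (\<rho> - 1) * gen_bessel p b c (complex_of_real t)) x =
         complex_of_real x powr (\<rho> + p - \<alpha> - \<alpha>' + \<gamma> - 1) / 2 powr p *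
         (Gamma (\<rho> + p) * Gamma (\<rho> + p + \<gamma> - \<alpha> - \<alpha>' - \<beta>) * Gamma (\<rho> + p + \<beta>' - \<alpha>') /
          (Gamma (\<rho> + p + \<beta>') * Gamma (\<rho> + p + \<gamma> - \<alpha> - \<alpha>') *
           Gamma (\<rho> + p + \<gamma> - \<alpha>' - \<beta>) * Gamma \<kappa>)) *
         hypergeo
           [(\<rho> + p) / 2, (\<rho> + p + 1) / 2,
            (\<rho> + p + \<gamma> - \<alpha> - \<alpha>' - \<beta>) / 2, (\<rho> + p + \<gamma> - \<alpha> - \<alpha>' - \<beta> + 1) / 2,
            (\<rho> + p + \<beta>' - \<alpha>') / 2, (\<rho> + p + \<beta>' - \<alpha>' + 1) / 2]
           [\<kappa>,
            (\<rho> + p + \<beta>') / 2, (\<rho> + p + \<beta>' + 1) / 2,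
            (\<rho> + p + \<gamma> - \<alpha> - \<alpha>') / 2, (\<rho> + p + \<gamma> - \<alpha> - \<alpha>' + 1) / 2,
            (\<rho> + p + \<gamma> - \<alpha>' - \<beta>) / 2, (\<rho> + p + \<gamma> - \<alpha>' - \<beta> + 1) / 2]
           (- c * complex_of_real x ^ 2 / 4)"
proof -
  let ?W = "\<lambda>t. complex_of_real t powr (\<rho> - 1) * gen_bessel p b c (complex_of_real t)"
  let ?S = "\<rho> + p"
  have r: "Re ?S > 0" "Re (?S + \<beta>' - \<alpha>') > 0" "Re (?S + \<gamma> - \<alpha> - \<alpha>' - \<beta>) > 0"
    using assms(4) by auto
  note main = msm_bessel[OF assms(3) r assms(8), where b = b and c = c]
  define as where "as = [?S / 2, (?S + 1) / 2,
            (?S + \<gamma> - \<alpha> - \<alpha>' - \<beta>) / 2, (?S + \<gamma> - \<alpha> - \<alpha>' - \<beta> + 1) / 2,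
            (?S + \<beta>' - \<alpha>') / 2, (?S + \<beta>' - \<alpha>' + 1) / 2]"
  define cs where "cs = [\<kappa>, (?S + \<beta>') / 2, (?S + \<beta>' + 1) / 2,
            (?S + \<gamma> - \<alpha> - \<alpha>') / 2, (?S + \<gamma> - \<alpha> - \<alpha>' + 1) / 2,
            (?S + \<gamma> - \<alpha>' - \<beta>) / 2, (?S + \<gamma> - \<alpha>' - \<beta> + 1) / 2]"
  define z where "z = - c * complex_of_real x ^ 2 / 4"
  define h where "h k = (\<Prod>a\<leftarrow>as. pochhammer a k) / ((\<Prod>c\<leftarrow>cs. pochhammer c k) * fact k) * z ^ k" for k
  define Q where "Q = Gamma \<gamma> * complex_of_real x powr (?S + \<gamma> - \<alpha>' - 1) * power_image \<alpha> \<alpha>' \<beta> \<beta>' \<gamma> ?S * rGamma \<kappa> / 2 powr p"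
  have tm: "bessel_coeff p b c k * (Gamma \<gamma> * complex_of_real x powr (?S + of_nat (2 * k) + \<gamma> - \<alpha>' - 1) *
             power_image \<alpha> \<alpha>' \<beta> \<beta>' \<gamma> (?S + of_nat (2 * k))) = Q * h k" for k
  proof -
    have "complex_of_real x powr (?S + of_nat (2 * k) + \<gamma> - \<alpha>' - 1) = complex_of_real x powr (?S + \<gamma> - \<alpha>' - 1) * complex_of_real x powr of_nat (2 * k)"
      by (subst powr_add[symmetric]) (simp add: algebra_simps)
    also have "complex_of_real x powr of_nat (2 * k) = (complex_of_real x ^ 2) ^ k"
      using assms(8) by (subst powr_complexpow) (auto simp: power_mult)
    finally have X: "complex_of_real x powr (?S + of_nat (2 * k) + \<gamma> - \<alpha>' - 1) = complex_of_real x powr (?S + \<gamma> - \<alpha>' - 1) * (complex_of_real x ^ 2) ^ k" .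
    have Z: "z ^ k = (- c / 4) ^ k * (complex_of_real x ^ 2) ^ k"
      unfolding z_def by (subst power_mult_distrib[symmetric]) simp
    have "pochhammer \<kappa> k \<noteq> 0" using assms(2) by (auto simp: pochhammer_eq_0_iff)
    then have K: "rGamma (p + (b + 1) / 2 + of_nat k) = rGamma \<kappa> / pochhammer \<kappa> k"
      using pochhammer_rGamma[of \<kappa> k] assms(1) by simp
    have I: "power_image \<alpha> \<alpha>' \<beta> \<beta>' \<gamma> (?S + of_nat (2 * k)) =
      power_image \<alpha> \<alpha>' \<beta> \<beta>' \<gamma> ?S *
     (pochhammer ?S (2 * k) * pochhammer (?S + \<gamma> - \<alpha> - \<alpha>' - \<beta>) (2 * k) * pochhammer (?S + \<beta>' - \<alpha>') (2 * k) /
      (pochhammer (?S + \<beta>') (2 * k) * pochhammer (?S + \<gamma> - \<alpha> - \<alpha>') (2 * k) * pochhammer (?S + \<gamma> - \<alpha>' - \<beta>) (2 * k)))"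
      by (intro power_image_shift assms(5-7) r[THEN not_nonpos_Int_if_Re_pos])
    show ?thesis
      unfolding X I bessel_coeff_def K Q_def h_def as_def cs_def Z pochhammer_even by (simp add: mult_ac)
  qed
  have sm: "(\<lambda>k. Q * h k) sums (LBINT t:{0<..<x}. msm_integrand \<alpha> \<alpha>' \<beta> \<beta>' \<gamma> ?W x t)"
    using main(2) unfolding tm .
  have "(LBINT t:{0<..<x}. msm_integrand \<alpha> \<alpha>' \<beta> \<beta>' \<gamma> ?W x t) = Q * hypergeo as cs z"
  \<comment> \<open>Summability of \<open>h\<close> follows from that of \<open>Q * h\<close> by cancelling \<open>Q\<close>; for \<open>Q = 0\<close> both sides vanish.\<close>
  proof (cases "Q = 0")
    case True
    with sums_unique[OF sm] show ?thesis by simp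
  next
    case False
    then have "summable h" using sums_summable[OF sm] by (simp add: summable_cmult_iff)
    then show ?thesis using sums_unique[OF sm] unfolding hypergeo_altdef h_def[symmetric] by (simp add: suminf_mult)
  qed
  moreover have "complex_of_real x powr (- \<alpha>) / Gamma \<gamma> * Q =
     complex_of_real x powr (?S - \<alpha> - \<alpha>' + \<gamma> - 1) / 2 powr p *
         (Gamma ?S * Gamma (?S + \<gamma> - \<alpha> - \<alpha>' - \<beta>) * Gamma (?S + \<beta>' - \<alpha>') /
          (Gamma (?S + \<beta>') * Gamma (?S + \<gamma> - \<alpha> - \<alpha>') * Gamma (?S + \<gamma> - \<alpha>' - \<beta>) * Gamma \<kappa>))"
  proof -
    have "complex_of_real x powr (?S - \<alpha> - \<alpha>' + \<gamma> - 1) = complex_of_real x powr (- \<alpha>) * complex_of_real x powr (?S + \<gamma> - \<alpha>' - 1)"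
      by (subst powr_add[symmetric]) (simp add: algebra_simps)
    moreover have "Gamma \<gamma> \<noteq> 0" using not_nonpos_Int_if_Re_pos[OF assms(3)] by (simp add: Gamma_eq_zero_iff)
    ultimately show ?thesis
      unfolding Q_def power_image_def rGamma_inverse_Gamma by (simp add: divide_inverse mult_ac)
  qed
  ultimately have "msm_integral \<alpha> \<alpha>' \<beta> \<beta>' \<gamma> ?W x = complex_of_real x powr (?S - \<alpha> - \<alpha>' + \<gamma> - 1) / 2 powr p *
         (Gamma ?S * Gamma (?S + \<gamma> - \<alpha> - \<alpha>' - \<beta>) * Gamma (?S + \<beta>' - \<alpha>') /
          (Gamma (?S + \<beta>') * Gamma (?S + \<gamma> - \<alpha> - \<alpha>') * Gamma (?S + \<gamma> - \<alpha>' - \<beta>) * Gamma \<kappa>)) * hypergeo as cs z"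
    unfolding msm_integral_def by (metis mult.assoc)
  with main(1) show ?thesis unfolding as_def cs_def z_def by blast
qed

end
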